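(* Let $\mathbf{k}$ be a unitary commutative ring, let $\lambda\in\mathbf{k}$, and let $A$ be a unitary commutative associative $\mathbf{k}$-algebra. Let $\mathrm{Sh}(A)=\bigoplus_{n\ge 1}A^{\otimes n}$ with the multiplication $\diamond_\lambda$, the right-shift operator $P_\lambda$ and the natural embedding $j_A:A\to \mathrm{Sh}(A)$, $a\mapsto a$, all as defined in the context. Then: (1) The triple $(\mathrm{Sh}(A),\diamond_\lambda,P_\lambda)$ is a commutative $\lambda$-TD algebra. (2) The quadruple $(\mathrm{Sh}(A),\diamond_\lambda,P_\lambda,j_A)$ is the free commutative $\lambda$-TD algebra on $A$: $j_A$ is an algebra homomorphism and for every commutative $\lambda$-TD algebra $(R,P)$ and every algebra homomorphism $f:A\to R$ there is a unique $\lambda$-TD algebra homomorphism $\bar f:\mathrm{Sh}(A)\to R$ such that $f=\bar f\circ j_A$.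
   Context: All algebras are unitary, commutative and associative over $\mathbf{k}$; algebra homomorphisms preserve units; tensor products and linear maps are over $\mathbf{k}$. A $\lambda$-TD algebra is an algebra $R$ with a linear operator $P:R\to R$ (a $\lambda$-TD operator) satisfying $P(x)P(y)=P\big(xP(y)+P(x)y+\lambda xy-xP(1)y\big)$ for all $x,y\in R$. A $\lambda$-TD algebra homomorphism $(R,P)\to(R',P')$ is an algebra homomorphism $g:R\to R'$ with $g\circ P=P'\circ g$. $\lambda$-TD shuffle product. Let $\mathrm{Sh}^+(A)=\bigoplus_{n\ge 0}A^{\otimes n}$, with $A^{\otimes 0}=\mathbf{k}$. The bilinear operation $\odot$ on $\mathrm{Sh}^+(A)$ is defined recursively on pure tensors: if one factor is a scalar $c\in\mathbf{k}=A^{\otimes 0}$, then $\odot$ is scalar multiplication by $c$ on the other factor; if $\mathfrak a=a_1\otimes\mathfrak a'\in A^{\otimes m}$, $\mathfrak b=b_1\otimes\mathfrak b'\in A^{\otimes n}$ with $m,n\ge 1$, $\mathfrak a'\in A^{\otimes(m-1)}$, $\mathfrak b'\in A^{\otimes (n-1)}$ (for $m=1$ take $\mathfrak a'=1_{\mathbf k}$, and similarly for $\mathfrak b'$; $a\otimes c$ with $c\in\mathbf{k}$ is identified with $ca$), then $$\mathfrak a\odot\mathfrak b=a_1\otimes(\mathfrak a'\odot\mathfrak b)+b_1\otimes(\mathfrak a\odot\mathfrak b')+\lambda a_1b_1\otimes(\mathfrak a'\odot\mathfrak b')-a_1b_1\otimes\big((\mathfrak a'\odot 1_A)\odot\mathfrak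 b'\big),$$ where $1_A\in A=A^{\otimes 1}$. Let $\mathrm{Sh}(A)=A\otimes \mathrm{Sh}^+(A)\cong\bigoplus_{n\ge1}A^{\otimes n}$. The multiplication $\diamond_\lambda$ is the bilinear operation with $(a_0\otimes\mathfrak a')\diamond_\lambda(b_0\otimes\mathfrak b')=a_0b_0\otimes(\mathfrak a'\odot\mathfrak b')$ for $a_0,b_0\in A$, $\mathfrak a',\mathfrak b'\in \mathrm{Sh}^+(A)$; its unit is $1_A\in A^{\otimes 1}$. The right-shift operator is the linear map $P_\lambda:\mathrm{Sh}(A)\to\mathrm{Sh}(A)$, $P_\lambda(\mathfrak a)=1_A\otimes\mathfrak a$ for $\mathfrak a\in A^{\otimes n}$, $n\ge1$. *)

theory Defs
  imports "HOL-Algebra.Module" "HOL-Algebra.QuotRing"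
begin

section \<open>Linear and bilinear maps, algebra homomorphisms\<close>

text \<open>
  Modules carry the ring fields \<^const>\<open>mult\<close> and \<^const>\<open>one\<close> by inheritance; nothing in
  \<^locale>\<open>module\<close> refers to them, and below they are left unspecified for objects that are only modules.
\<close>

definition linear_maps ::
  "('k, 'm) ring_scheme \<Rightarrow> ('k, 'a, 'n) module_scheme \<Rightarrow> ('k, 'b, 'p) module_scheme \<Rightarrow> ('a \<Rightarrow> 'b) set"
  where "linear_maps K M N =
    {f \<in> carrier M \<rightarrow> carrier N.
      (\<forall>x\<in>carrier M. \<forall>y\<in>carrier M. f (x \<oplus>\<^bsub>M\<^esub> y) = f x \<oplus>\<^bsub>N\<^esub> f y) \<and>
      (\<forall>c\<in>carrier K. \<forall>x\<in>carrier M. f (c \<odot>\<^bsub>M\<^esub> x) = c \<odot>\<^bsub>N\<^esub> f x)}"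

definition bilinear_op ::
  "('k, 'm) ring_scheme \<Rightarrow> ('k, 'a, 'n) module_scheme \<Rightarrow> ('a \<Rightarrow> 'a \<Rightarrow> 'a) \<Rightarrow> bool"
  where "bilinear_op K M f \<longleftrightarrow>
    (\<forall>x\<in>carrier M. f x \<in> linear_maps K M M \<and> (\<lambda>y. f y x) \<in> linear_maps K M M)"

definition algebra_hom ::
  "('k, 'm) ring_scheme \<Rightarrow> ('k, 'a, 'n) module_scheme \<Rightarrow> ('k, 'b, 'p) module_scheme \<Rightarrow> ('a \<Rightarrow> 'b) set"
  where "algebra_hom K A B = ring_hom A B \<inter> linear_maps K A B"


section \<open>Free modules, quotient modules, direct sums\<close>

definition free_module :: "('k, 'm) ring_scheme \<Rightarrow> 'x set \<Rightarrow> ('k, 'x \<Rightarrow> 'k) module"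
  where "free_module K X =
    \<lparr>carrier = {f. (\<forall>x. f x \<in> carrier K) \<and> (\<forall>x. x \<notin> X \<longrightarrow> f x = \<zero>\<^bsub>K\<^esub>) \<and> finite {x. f x \<noteq> \<zero>\<^bsub>K\<^esub>}},
     mult = undefined,
     one = undefined,
     zero = (\<lambda>x. \<zero>\<^bsub>K\<^esub>),
     add = (\<lambda>f g x. f x \<oplus>\<^bsub>K\<^esub> g x),
     smult = (\<lambda>c f x. c \<otimes>\<^bsub>K\<^esub> f x)\<rparr>"

definition free_gen :: "('k, 'm) ring_scheme \<Rightarrow> 'x \<Rightarrow> 'x \<Rightarrow> 'k"
  where "free_gen K x = (\<lambda>y. if y = x then \<one>\<^bsub>K\<^esub> else \<zero>\<^bsub>K\<^esub>)"

definition submodule_span ::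
  "('k, 'm) ring_scheme \<Rightarrow> ('k, 'a, 'n) module_scheme \<Rightarrow> 'a set \<Rightarrow> 'a set"
  where "submodule_span K M S = \<Inter>{N. submodule N K M \<and> S \<subseteq> N}"

text \<open>The module analogue of \<^const>\<open>FactRing\<close>.\<close>

definition quotient_module ::
  "('k, 'a, 'n) module_scheme \<Rightarrow> 'a set \<Rightarrow> ('k, 'a set) module"
  where "quotient_module M N =
    \<lparr>carrier = a_rcosets\<^bsub>M\<^esub> N,
     mult = undefined,
     one = undefined,
     zero = N,
     add = set_add M,
     smult = (\<lambda>c X. \<Union>x\<in>X. N +>\<^bsub>M\<^esub> (c \<odot>\<^bsub>M\<^esub> x))\<rparr>"

definition direct_sum :: "('i \<Rightarrow> ('k, 'a, 'n) module_scheme) \<Rightarrow> ('k, 'i \<Rightarrow> 'a) module"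
  where "direct_sum T =
    \<lparr>carrier = {x. (\<forall>i. x i \<in> carrier (T i)) \<and> finite {i. x i \<noteq> \<zero>\<^bsub>T i\<^esub>}},
     mult = undefined,
     one = undefined,
     zero = (\<lambda>i. \<zero>\<^bsub>T i\<^esub>),
     add = (\<lambda>x y i. x i \<oplus>\<^bsub>T i\<^esub> y i),
     smult = (\<lambda>c x i. c \<odot>\<^bsub>T i\<^esub> x i)\<rparr>"


section \<open>Tensor powers and the module \<open>Sh\<^sup>+(A)\<close>\<close>

text \<open>
  The tensor power \<open>A\<^sup>\<otimes>\<^sup>n\<close> is the free module on \<open>A\<^sup>n\<close> (lists of length \<open>n\<close>) modulo the
  multilinearity relations. In particular \<open>A\<^sup>\<otimes>\<^sup>0\<close> is free on the empty list, and \<open>c \<in> K\<close> corresponds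
  to \<open>c\<close> times the class of the empty list; \<open>A\<^sup>\<otimes>\<^sup>1\<close> is identified with \<open>A\<close> via the class
  of \<open>[a]\<close>.
\<close>

definition tensor_words :: "('k, 'a, 'n) module_scheme \<Rightarrow> nat \<Rightarrow> 'a list set"
  where "tensor_words A n = {w. set w \<subseteq> carrier A \<and> length w = n}"

definition word_module ::
  "('k, 'm) ring_scheme \<Rightarrow> ('k, 'a, 'n) module_scheme \<Rightarrow> nat \<Rightarrow> ('k, 'a list \<Rightarrow> 'k) module"
  where "word_module K A n = free_module K (tensor_words A n)"

definition tensor_relations ::
  "('k, 'm) ring_scheme \<Rightarrow> ('k, 'a, 'n) module_scheme \<Rightarrow> nat \<Rightarrow> ('a list \<Rightarrow> 'k) set"
  where "tensor_relations K A n =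
    {free_gen K (u @ (x \<oplus>\<^bsub>A\<^esub> y) # v)
       \<ominus>\<^bsub>word_module K A n\<^esub> (free_gen K (u @ x # v) \<oplus>\<^bsub>word_module K A n\<^esub> free_gen K (u @ y # v))
     | u v x y. set u \<subseteq> carrier A \<and> set v \<subseteq> carrier A \<and> x \<in> carrier A \<and> y \<in> carrier A \<and>
         length u + 1 + length v = n} \<union>
    {free_gen K (u @ (c \<odot>\<^bsub>A\<^esub> x) # v)
       \<ominus>\<^bsub>word_module K A n\<^esub> (c \<odot>\<^bsub>word_module K A n\<^esub> free_gen K (u @ x # v))
     | u v c x. set u \<subseteq> carrier A \<and> set v \<subseteq> carrier A \<and> c \<in> carrier K \<and> x \<in> carrier A \<and>
         length u + 1 + length v = n}"

definition tensor_null ::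
  "('k, 'm) ring_scheme \<Rightarrow> ('k, 'a, 'n) module_scheme \<Rightarrow> nat \<Rightarrow> ('a list \<Rightarrow> 'k) set"
  where "tensor_null K A n = submodule_span K (word_module K A n) (tensor_relations K A n)"

definition tensor_power ::
  "('k, 'm) ring_scheme \<Rightarrow> ('k, 'a, 'n) module_scheme \<Rightarrow> nat \<Rightarrow> ('k, ('a list \<Rightarrow> 'k) set) module"
  where "tensor_power K A n = quotient_module (word_module K A n) (tensor_null K A n)"

type_synonym ('k, 'a) tensors = "nat \<Rightarrow> ('a list \<Rightarrow> 'k) set"

definition Sh_plus ::
  "('k, 'm) ring_scheme \<Rightarrow> ('k, 'a, 'n) module_scheme \<Rightarrow> ('k, ('k, 'a) tensors) module"
  where "Sh_plus K A = direct_sum (tensor_power K A)"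

text \<open>The list \<open>[a\<^sub>1, \<dots>, a\<^sub>n]\<close> represents the pure tensor \<open>a\<^sub>1 \<otimes> \<dots> \<otimes> a\<^sub>n\<close>, concentrated in degree \<open>n\<close>.\<close>

definition pure_tensor ::
  "('k, 'm) ring_scheme \<Rightarrow> ('k, 'a, 'n) module_scheme \<Rightarrow> 'a list \<Rightarrow> ('k, 'a) tensors"
  where "pure_tensor K A w =
    (\<lambda>n. if n = length w then tensor_null K A n +>\<^bsub>word_module K A n\<^esub> free_gen K w
         else \<zero>\<^bsub>tensor_power K A n\<^esub>)"

text \<open>
  The linear map \<open>x \<mapsto> a \<otimes> x\<close> on \<open>Sh\<^sup>+(A)\<close>. On degree \<open>0\<close> it sends \<open>c\<close> to \<open>c a\<close>, which is
  the identification of \<open>a \<otimes> c\<close> with \<open>c a\<close>. Here and below, a map that is prescribed on pure tensors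
  and extended (bi)linearly is given by definite description; requiring it to be extensional makes it
  unique as a total function.
\<close>

definition tensor_cons ::
  "('k, 'm) ring_scheme \<Rightarrow> ('k, 'a, 'n) module_scheme \<Rightarrow> 'a \<Rightarrow> ('k, 'a) tensors \<Rightarrow> ('k, 'a) tensors"
  where "tensor_cons K A a =
    (THE f. f \<in> extensional (carrier (Sh_plus K A)) \<and>
            f \<in> linear_maps K (Sh_plus K A) (Sh_plus K A) \<and>
            (\<forall>w\<in>lists (carrier A). f (pure_tensor K A w) = pure_tensor K A (a # w)))"


section \<open>The shuffle product and the algebra \<open>Sh(A)\<close>\<close>

definition extensional_op :: "'a set \<Rightarrow> ('a \<Rightarrow> 'a \<Rightarrow> 'a) \<Rightarrow> bool"
  where "extensional_op S f \<longleftrightarrow> (\<forall>x y. x \<notin> S \<or> y \<notin> S \<longrightarrow> f x y = undefined)"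

definition is_td_shuffle ::
  "('k, 'm) ring_scheme \<Rightarrow> ('k, 'a, 'n) module_scheme \<Rightarrow> 'k \<Rightarrow>
   (('k, 'a) tensors \<Rightarrow> ('k, 'a) tensors \<Rightarrow> ('k, 'a) tensors) \<Rightarrow> bool"
  where "is_td_shuffle K A l sh \<longleftrightarrow>
    (let S = Sh_plus K A; p = pure_tensor K A; t = tensor_cons K A in
      bilinear_op K S sh \<and>
      (\<forall>c\<in>carrier K. \<forall>x\<in>carrier S.
         sh (c \<odot>\<^bsub>S\<^esub> p []) x = c \<odot>\<^bsub>S\<^esub> x \<and> sh x (c \<odot>\<^bsub>S\<^esub> p []) = c \<odot>\<^bsub>S\<^esub> x) \<and>
      (\<forall>a\<in>carrier A. \<forall>b\<in>carrier A. \<forall>u\<in>lists (carrier A). \<forall>v\<in>lists (carrier A).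
         sh (p (a # u)) (p (b # v)) =
           t a (sh (p u) (p (b # v)))
           \<oplus>\<^bsub>S\<^esub> t b (sh (p (a # u)) (p v))
           \<oplus>\<^bsub>S\<^esub> l \<odot>\<^bsub>S\<^esub> t (a \<otimes>\<^bsub>A\<^esub> b) (sh (p u) (p v))
           \<ominus>\<^bsub>S\<^esub> t (a \<otimes>\<^bsub>A\<^esub> b) (sh (sh (p u) (p [\<one>\<^bsub>A\<^esub>])) (p v))))"

definition td_shuffle ::
  "('k, 'm) ring_scheme \<Rightarrow> ('k, 'a, 'n) module_scheme \<Rightarrow> 'k \<Rightarrow>
   ('k, 'a) tensors \<Rightarrow> ('k, 'a) tensors \<Rightarrow> ('k, 'a) tensors"
  where "td_shuffle K A l =
    (THE sh. extensional_op (carrier (Sh_plus K A)) sh \<and> is_td_shuffle K A l sh)"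

text \<open>\<open>Sh(A)\<close> is the submodule of \<open>Sh\<^sup>+(A)\<close> of families whose component in degree \<open>0\<close> vanishes.\<close>

definition Sh_module ::
  "('k, 'm) ring_scheme \<Rightarrow> ('k, 'a, 'n) module_scheme \<Rightarrow> ('k, ('k, 'a) tensors) module"
  where "Sh_module K A =
    (Sh_plus K A)\<lparr>carrier := {x \<in> carrier (Sh_plus K A). x 0 = \<zero>\<^bsub>tensor_power K A 0\<^esub>}\<rparr>"

definition td_diamond ::
  "('k, 'm) ring_scheme \<Rightarrow> ('k, 'a, 'n) module_scheme \<Rightarrow> 'k \<Rightarrow>
   ('k, 'a) tensors \<Rightarrow> ('k, 'a) tensors \<Rightarrow> ('k, 'a) tensors"
  where "td_diamond K A l =
    (THE d. extensional_op (carrier (Sh_module K A)) d \<and>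
            bilinear_op K (Sh_module K A) d \<and>
            (\<forall>a\<in>carrier A. \<forall>b\<in>carrier A.
              \<forall>x\<in>carrier (Sh_plus K A). \<forall>y\<in>carrier (Sh_plus K A).
                d (tensor_cons K A a x) (tensor_cons K A b y) =
                  tensor_cons K A (a \<otimes>\<^bsub>A\<^esub> b) (td_shuffle K A l x y)))"

definition Sh ::
  "('k, 'm) ring_scheme \<Rightarrow> ('k, 'a, 'n) module_scheme \<Rightarrow> 'k \<Rightarrow> ('k, ('k, 'a) tensors) module"
  where "Sh K A l = (Sh_module K A)\<lparr>mult := td_diamond K A l, one := pure_tensor K A [\<one>\<^bsub>A\<^esub>]\<rparr>"

definition right_shift ::
  "('k, 'm) ring_scheme \<Rightarrow> ('k, 'a, 'n) module_scheme \<Rightarrow> ('k, 'a) tensors \<Rightarrow> ('k, 'a) tensors"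
  where "right_shift K A = tensor_cons K A \<one>\<^bsub>A\<^esub>"

definition Sh_embed ::
  "('k, 'm) ring_scheme \<Rightarrow> ('k, 'a, 'n) module_scheme \<Rightarrow> 'a \<Rightarrow> ('k, 'a) tensors"
  where "Sh_embed K A a = pure_tensor K A [a]"


section \<open>\<open>\<lambda>\<close>-TD algebras\<close>

text \<open>The locale \<^locale>\<open>algebra\<close> already comprises commutativity, associativity and the unit.\<close>

locale td_algebra = algebra K R
  for K :: "('k, 'm) ring_scheme" and R :: "('k, 'r, 'q) module_scheme" +
  fixes l :: 'k and P :: "'r \<Rightarrow> 'r"
  assumes P_linear: "P \<in> linear_maps K R R"
    and P_td: "\<lbrakk>x \<in> carrier R; y \<in> carrier R\<rbrakk> \<Longrightarrow>
      P x \<otimes>\<^bsub>R\<^esub> P y =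
        P (x \<otimes>\<^bsub>R\<^esub> P y \<oplus>\<^bsub>R\<^esub> P x \<otimes>\<^bsub>R\<^esub> y \<oplus>\<^bsub>R\<^esub> l \<odot>\<^bsub>R\<^esub> (x \<otimes>\<^bsub>R\<^esub> y)
           \<ominus>\<^bsub>R\<^esub> x \<otimes>\<^bsub>R\<^esub> P \<one>\<^bsub>R\<^esub> \<otimes>\<^bsub>R\<^esub> y)"

definition td_hom ::
  "('k, 'm) ring_scheme \<Rightarrow> ('k, 'a, 'n) module_scheme \<Rightarrow> ('a \<Rightarrow> 'a) \<Rightarrow>
   ('k, 'b, 'p) module_scheme \<Rightarrow> ('b \<Rightarrow> 'b) \<Rightarrow> ('a \<Rightarrow> 'b) set"
  where "td_hom K R P R' P' = {g \<in> algebra_hom K R R'. \<forall>x\<in>carrier R. g (P x) = P' (g x)}"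

end

(*
  Write 1_A for the unit of A in tensor degree 1, e for the projection onto degree 0, and let
  tau(x) = l e(x) - 1_A \<otimes> x. On pure tensors x = a \<otimes> x' and y = b \<otimes> y' the shuffle recursion is
  equivalent to
    x * y = a \<otimes> (x' * y) + b \<otimes> (x * y') + ab \<otimes> tau(x' * y'),
  which is symmetric and recurses structurally. By induction on z, tau(w) * z = tau(w * z); thus tau is
  multiplication by l - 1_A, which gives back the original recursion. With this commutation rule both
  bracketings of a triple product expand to the same seven terms, so * is associative, and
  (a \<otimes> x) (b \<otimes> y) = ab \<otimes> (x * y) inherits the ring axioms; the TD identity is the recursion itself.
  For the universal property put h(1) = 1 and h(a \<otimes> x) = P(f(a) h(x)). Since h(tau(x)) = h(x) (l - P(1)),
  the TD identity in R makes h multiplicative for *, and the required map is a \<otimes> x \<mapsto> f(a) h(x).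
*)
theory Submission
  imports Defs
begin

section \<open>Linear maps\<close>

text \<open>The products and prefix maps of the statement are given by definite description, so
  existence and uniqueness must be settled before any identity can be used. A map on classes in a
  quotient is built from a function of words that is linear in each letter, and a linear map is
  determined by its values on pure tensors. Every construction and identity below is brought to
  words in this way. The stated recursion resists this: its term (a' * 1_A) * b' feeds a product,
  which is not a word, back into the recursion. The correction tau comes from computing l x - x *
  1_A in advance. For x = a \<otimes> x' the two terms a \<otimes> (x' * 1_A) of the recursion
  cancel and leave x * 1_A = 1_A \<otimes> x + l x, so the difference is -1_A \<otimes> x, while a
  scalar c gives l c - 1_A \<otimes> c. The projection e accounts for this discrepancy in degree 0.
  The same cancellation is what makes the stated recursion determine its solution.\<close>

lemma linear_mapsI:
  assumes "\<And>x. x \<in> carrier M \<Longrightarrow> f x \<in> carrier N"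
    and "\<And>x y. x \<in> carrier M \<Longrightarrow> y \<in> carrier M \<Longrightarrow> f (x \<oplus>\<^bsub>M\<^esub> y) = f x \<oplus>\<^bsub>N\<^esub> f y"
    and "\<And>c x. c \<in> carrier K \<Longrightarrow> x \<in> carrier M \<Longrightarrow> f (c \<odot>\<^bsub>M\<^esub> x) = c \<odot>\<^bsub>N\<^esub> f x"
  shows "f \<in> linear_maps K M N"
  using assms by (auto simp: linear_maps_def)

lemma linear_mapsD:
  assumes "f \<in> linear_maps K M N"
  shows "\<And>x. x \<in> carrier M \<Longrightarrow> f x \<in> carrier N"
    and "\<And>x y. x \<in> carrier M \<Longrightarrow> y \<in> carrier M \<Longrightarrow> f (x \<oplus>\<^bsub>M\<^esub> y) = f x \<oplus>\<^bsub>N\<^esub> f y"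
    and "\<And>c x. c \<in> carrier K \<Longrightarrow> x \<in> carrier M \<Longrightarrow> f (c \<odot>\<^bsub>M\<^esub> x) = c \<odot>\<^bsub>N\<^esub> f x"
  using assms by (auto simp: linear_maps_def)

lemma linear_maps_zero:
  assumes "module K M" "module K N" "f \<in> linear_maps K M N"
  shows "f \<zero>\<^bsub>M\<^esub> = \<zero>\<^bsub>N\<^esub>"
proof -
  interpret M: module K M by fact
  interpret N: module K N by fact
  have "f (\<zero>\<^bsub>K\<^esub> \<odot>\<^bsub>M\<^esub> \<zero>\<^bsub>M\<^esub>) = \<zero>\<^bsub>K\<^esub> \<odot>\<^bsub>N\<^esub> f \<zero>\<^bsub>M\<^esub>"
    using linear_mapsD(3)[OF assms(3)] by blast
  then show ?thesis using linear_mapsD(1)[OF assms(3)] by simp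
qed

text \<open>The right-hand side uses only the scalar action, whereas \<open>a_inv\<close> searches
  the carrier; it also makes linear maps respect negation by homogeneity alone.\<close>

lemma (in module) neg_eq_smult: "x \<in> carrier M \<Longrightarrow> \<ominus>\<^bsub>M\<^esub> x = (\<ominus> \<one>) \<odot>\<^bsub>M\<^esub> x"
  by (simp add: smult_l_minus)

lemma (in abelian_group) minus_eq_zero_iff:
  assumes "x \<in> carrier G" "y \<in> carrier G"
  shows "x \<ominus> y = \<zero> \<longleftrightarrow> x = y"
proof
  assume "x \<ominus> y = \<zero>"
  then have "x \<oplus> (\<ominus> y \<oplus> y) = y" using assms by (simp add: a_minus_def a_assoc[symmetric])
  then show "x = y" using assms by (simp add: l_neg)
qed (use assms in \<open>simp add: a_minus_def r_neg\<close>)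

lemma (in abelian_group) add_minus_cancel:
  assumes "x \<in> carrier G" "y \<in> carrier G"
  shows "x \<oplus> (y \<ominus> x) = y"
proof -
  have "x \<oplus> (y \<ominus> x) = y \<oplus> (x \<oplus> \<ominus> x)" using assms by (simp add: a_minus_def a_lcomm)
  then show ?thesis using assms by (simp add: r_neg)
qed

lemma (in abelian_group) minus_add_cancel:
  assumes "x \<in> carrier G" "y \<in> carrier G"
  shows "y \<ominus> (x \<oplus> y) = \<ominus> x"
proof -
  have "y \<ominus> (x \<oplus> y) = \<ominus> x \<oplus> (y \<oplus> \<ominus> y)" using assms by (simp add: a_minus_def minus_add a_lcomm)
  then show ?thesis using assms by (simp add: r_neg)
qed

lemma linear_maps_neg:
  assumes "module K M" "module K N" "f \<in> linear_maps K M N" "x \<in> carrier M"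
  shows "f (\<ominus>\<^bsub>M\<^esub> x) = \<ominus>\<^bsub>N\<^esub> f x"
proof -
  interpret M: module K M by fact
  interpret N: module K N by fact
  show ?thesis using linear_mapsD[OF assms(3)] assms(4) by (simp add: M.neg_eq_smult N.neg_eq_smult)
qed

lemma linear_maps_minus:
  assumes "module K M" "module K N" "f \<in> linear_maps K M N" "x \<in> carrier M" "y \<in> carrier M"
  shows "f (x \<ominus>\<^bsub>M\<^esub> y) = f x \<ominus>\<^bsub>N\<^esub> f y"
proof -
  interpret M: module K M by fact
  show ?thesis using linear_mapsD[OF assms(3)] linear_maps_neg[OF assms(1-3)] assms(4,5)
    by (simp add: a_minus_def)
qed

lemma linear_maps_comp:
  assumes "f \<in> linear_maps K L M" "g \<in> linear_maps K M N"
  shows "(\<lambda>x. g (f x)) \<in> linear_maps K L N"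
  using assms by (auto simp: linear_maps_def Pi_def)

text \<open>Passing to the \<open>extensional\<close> representative changes values only outside the
  carrier, and the module operations never leave the carrier.\<close>

lemma linear_maps_restrict:
  assumes "module K M" "f \<in> linear_maps K M N"
  shows "restrict f (carrier M) \<in> linear_maps K M N"
proof -
  interpret M: module K M by fact
  show ?thesis using assms(2) by (auto simp: linear_maps_def)
qed

lemma linear_maps_add:
  assumes "module K N" "f \<in> linear_maps K M N" "g \<in> linear_maps K M N"
  shows "(\<lambda>x. f x \<oplus>\<^bsub>N\<^esub> g x) \<in> linear_maps K M N"
proof -
  interpret N: module K N by fact
  show ?thesis using linear_mapsD[OF assms(2)] linear_mapsD[OF assms(3)]
    by (intro linear_mapsI) (simp_all add: N.smult_r_distr N.M.a_ac)
qed

lemma linear_maps_smult: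
  assumes "module K N" "f \<in> linear_maps K M N" "d \<in> carrier K"
  shows "(\<lambda>x. d \<odot>\<^bsub>N\<^esub> f x) \<in> linear_maps K M N"
proof -
  interpret N: module K N by fact
  show ?thesis using linear_mapsD[OF assms(2)] assms(3)
    by (intro linear_mapsI) (simp_all add: N.smult_r_distr N.smult_assoc1[symmetric] N.R.m_comm)
qed

lemma linear_maps_diff:
  assumes "module K N" "f \<in> linear_maps K M N" "g \<in> linear_maps K M N"
  shows "(\<lambda>x. f x \<ominus>\<^bsub>N\<^esub> g x) \<in> linear_maps K M N"
proof -
  interpret N: module K N by fact
  show ?thesis using linear_mapsD[OF assms(2)] linear_mapsD[OF assms(3)]
    by (intro linear_mapsI)
      (simp_all add: N.smult_r_distr N.smult_r_minus a_minus_def N.M.a_ac N.M.minus_add)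
qed

lemma linear_maps_null:
  assumes "module K N"
  shows "(\<lambda>x. \<zero>\<^bsub>N\<^esub>) \<in> linear_maps K M N"
proof -
  interpret N: module K N by fact
  show ?thesis by (intro linear_mapsI) simp_all
qed

text \<open>Serves twice: a linear map that kills a set of relations kills the submodule they span,
  and \<open>Sh_module\<close> is the kernel of the projection onto degree 0.\<close>

lemma linear_kernel_submodule:
  assumes "module K M" "module K N" "f \<in> linear_maps K M N"
  shows "submodule {x \<in> carrier M. f x = \<zero>\<^bsub>N\<^esub>} K M"
proof -
  interpret M: module K M by fact
  interpret N: module K N by fact
  show ?thesis
    by (rule M.submoduleI)
      (auto simp: linear_mapsD[OF assms(3)] linear_maps_zero[OF assms] linear_maps_neg[OF assms])
qed

lemma bilinear_opD:
  assumes "bilinear_op K M f"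
  shows "\<And>x. x \<in> carrier M \<Longrightarrow> f x \<in> linear_maps K M M"
    and "\<And>y. y \<in> carrier M \<Longrightarrow> (\<lambda>x. f x y) \<in> linear_maps K M M"
    and "\<And>x y. x \<in> carrier M \<Longrightarrow> y \<in> carrier M \<Longrightarrow> f x y \<in> carrier M"
  using assms by (auto simp: bilinear_op_def linear_maps_def)

section \<open>Free modules, quotient modules and direct sums\<close>

lemma (in abelian_monoid) finsum_support_extend:
  assumes "finite F" "{i. h i \<noteq> \<zero>} \<subseteq> B" "B \<subseteq> F" "\<And>i. h i \<in> carrier G"
  shows "finsum G h B = finsum G h F"
  using assms by (intro add.finprod_mono_neutral_cong_left) auto

text \<open>Abstract in the components so that free modules and direct sums share the computation:
  \<open>C i\<close>, \<open>z i\<close> and \<open>ad i\<close> are carrier, zero and addition of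
  component \<open>i\<close>, and \<open>h i\<close> is additive. The three sums run over different
  supports; all are enlarged to the union of the supports of \<open>x\<close> and \<open>y\<close>,
  where the extra terms vanish.\<close>

lemma (in abelian_monoid) finsum_support_add:
  assumes h: "\<And>i c. c \<in> C i \<Longrightarrow> h i c \<in> carrier G" "\<And>i. h i (z i) = \<zero>"
      "\<And>i c d. c \<in> C i \<Longrightarrow> d \<in> C i \<Longrightarrow> h i (ad i c d) = h i c \<oplus> h i d"
    and ad: "\<And>i c d. c \<in> C i \<Longrightarrow> d \<in> C i \<Longrightarrow> ad i c d \<in> C i" "\<And>i. ad i (z i) (z i) = z i"
    and x: "\<And>i. x i \<in> C i" "finite {i. x i \<noteq> z i}"
    and y: "\<And>i. y i \<in> C i" "finite {i. y i \<noteq> z i}"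
  shows "finsum G (\<lambda>i. h i (ad i (x i) (y i))) {i. ad i (x i) (y i) \<noteq> z i} =
    finsum G (\<lambda>i. h i (x i)) {i. x i \<noteq> z i} \<oplus> finsum G (\<lambda>i. h i (y i)) {i. y i \<noteq> z i}"
proof -
  let ?F = "{i. x i \<noteq> z i} \<union> {i. y i \<noteq> z i}"
  have F: "finite ?F" using x y by simp
  have s: "{i. ad i (x i) (y i) \<noteq> z i} \<subseteq> ?F" using ad(2) by auto
  have "finsum G (\<lambda>i. h i (ad i (x i) (y i))) {i. ad i (x i) (y i) \<noteq> z i} =
    finsum G (\<lambda>i. h i (ad i (x i) (y i))) ?F"
    using h(2) x(1) y(1) ad(1) by (intro finsum_support_extend[OF F _ s]) (auto simp: h(1))
  also have "\<dots> = finsum G (\<lambda>i. h i (x i) \<oplus> h i (y i)) ?F"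
    using x(1) y(1) h by (intro finsum_cong') auto
  also have "\<dots> = finsum G (\<lambda>i. h i (x i)) ?F \<oplus> finsum G (\<lambda>i. h i (y i)) ?F"
    using x(1) y(1) h by (intro finsum_addf) auto
  also have "finsum G (\<lambda>i. h i (x i)) ?F = finsum G (\<lambda>i. h i (x i)) {i. x i \<noteq> z i}"
    using x(1) h by (intro finsum_support_extend[OF F, symmetric]) auto
  also have "finsum G (\<lambda>i. h i (y i)) ?F = finsum G (\<lambda>i. h i (y i)) {i. y i \<noteq> z i}"
    using y(1) h by (intro finsum_support_extend[OF F, symmetric]) auto
  finally show ?thesis .
qed

lemma (in module) finsum_support_smult:
  assumes h: "\<And>i c. c \<in> C i \<Longrightarrow> h i c \<in> carrier M" "\<And>i. h i (z i) = \<zero>\<^bsub>M\<^esub>"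
      "\<And>i c. c \<in> C i \<Longrightarrow> h i (sm i c) = d \<odot>\<^bsub>M\<^esub> h i c"
    and sm: "\<And>i c. c \<in> C i \<Longrightarrow> sm i c \<in> C i" "\<And>i. sm i (z i) = z i"
    and x: "\<And>i. x i \<in> C i" "finite {i. x i \<noteq> z i}" and d: "d \<in> carrier R"
  shows "finsum M (\<lambda>i. h i (sm i (x i))) {i. sm i (x i) \<noteq> z i} =
    d \<odot>\<^bsub>M\<^esub> finsum M (\<lambda>i. h i (x i)) {i. x i \<noteq> z i}"
proof -
  have s: "{i. sm i (x i) \<noteq> z i} \<subseteq> {i. x i \<noteq> z i}" using sm(2) by auto
  have "finsum M (\<lambda>i. h i (sm i (x i))) {i. sm i (x i) \<noteq> z i} =
    finsum M (\<lambda>i. h i (sm i (x i))) {i. x i \<noteq> z i}"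
    using h(2) x(1) sm(1) by (intro M.finsum_support_extend[OF x(2) _ s]) (auto simp: h(1))
  also have "\<dots> = finsum M (\<lambda>i. d \<odot>\<^bsub>M\<^esub> h i (x i)) {i. x i \<noteq> z i}"
    using x(1) h d by (intro M.finsum_cong') auto
  also have "\<dots> = d \<odot>\<^bsub>M\<^esub> finsum M (\<lambda>i. h i (x i)) {i. x i \<noteq> z i}"
    using x h d by (intro finsum_smult_ldistr[symmetric]) auto
  finally show ?thesis .
qed

section \<open>Free modules and their universal property\<close>

lemma free_module_simps:
  "carrier (free_module K X) =
    {f. (\<forall>x. f x \<in> carrier K) \<and> (\<forall>x. x \<notin> X \<longrightarrow> f x = \<zero>\<^bsub>K\<^esub>) \<and> finite {x. f x \<noteq> \<zero>\<^bsub>K\<^esub>}}"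
  "\<zero>\<^bsub>free_module K X\<^esub> = (\<lambda>x. \<zero>\<^bsub>K\<^esub>)"
  "f \<oplus>\<^bsub>free_module K X\<^esub> g = (\<lambda>x. f x \<oplus>\<^bsub>K\<^esub> g x)"
  "c \<odot>\<^bsub>free_module K X\<^esub> f = (\<lambda>x. c \<otimes>\<^bsub>K\<^esub> f x)"
  by (simp_all add: free_module_def)

context cring
begin

lemma free_module_module: "module R (free_module R X)"
proof (rule moduleI)
  have add: "f \<oplus>\<^bsub>free_module R X\<^esub> g \<in> carrier (free_module R X)"
    if "f \<in> carrier (free_module R X)" "g \<in> carrier (free_module R X)" for f g
  proof -
    have "{x. f x \<oplus> g x \<noteq> \<zero>} \<subseteq> {x. f x \<noteq> \<zero>} \<union> {x. g x \<noteq> \<zero>}" using that by auto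
    then show ?thesis using that by (auto simp: free_module_simps intro: finite_subset)
  qed
  have smult: "c \<odot>\<^bsub>free_module R X\<^esub> f \<in> carrier (free_module R X)"
    if "c \<in> carrier R" "f \<in> carrier (free_module R X)" for f c
  proof -
    have "{x. c \<otimes> f x \<noteq> \<zero>} \<subseteq> {x. f x \<noteq> \<zero>}" using that by auto
    then show ?thesis using that by (auto simp: free_module_simps intro: finite_subset)
  qed
  show "abelian_group (free_module R X)"
  proof (rule abelian_groupI)
    fix f assume f: "f \<in> carrier (free_module R X)"
    \<comment> \<open>The inverse of \<open>f\<close> is \<open>f\<close> scaled by -1, whose finite
      support is covered by closure under scalars.\<close>
    have "(\<ominus> \<one>) \<odot>\<^bsub>free_module R X\<^esub> f \<oplus>\<^bsub>free_module R X\<^esub> f = \<zero>\<^bsub>free_module R X\<^esub>"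
      using f by (auto simp: free_module_simps l_minus l_neg)
    then show "\<exists>g\<in>carrier (free_module R X). g \<oplus>\<^bsub>free_module R X\<^esub> f = \<zero>\<^bsub>free_module R X\<^esub>"
      using smult f by (metis a_inv_closed one_closed)
  qed (use add in \<open>auto simp: free_module_simps a_ac\<close>)
  show "c \<odot>\<^bsub>free_module R X\<^esub> f \<in> carrier (free_module R X)"
    if "c \<in> carrier R" "f \<in> carrier (free_module R X)" for c f
    using smult that .
qed (auto simp: free_module_simps l_distr r_distr m_assoc is_cring)

lemma free_gen_carrier: "x \<in> X \<Longrightarrow> free_gen R x \<in> carrier (free_module R X)"
  by (auto simp: free_module_simps free_gen_def)

text \<open>Induction on the number of points in the support: resetting one point to zero splits off
  a scalar multiple of a generator.\<close>

lemma free_module_induct [consumes 1, case_names zero gen add smult]: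
  assumes "f \<in> carrier (free_module R X)"
    and zero: "Q \<zero>\<^bsub>free_module R X\<^esub>"
    and gen: "\<And>x. x \<in> X \<Longrightarrow> Q (free_gen R x)"
    and add: "\<And>f g. f \<in> carrier (free_module R X) \<Longrightarrow> g \<in> carrier (free_module R X) \<Longrightarrow>
      Q f \<Longrightarrow> Q g \<Longrightarrow> Q (f \<oplus>\<^bsub>free_module R X\<^esub> g)"
    and smult: "\<And>c f. c \<in> carrier R \<Longrightarrow> f \<in> carrier (free_module R X) \<Longrightarrow> Q f \<Longrightarrow>
      Q (c \<odot>\<^bsub>free_module R X\<^esub> f)"
  shows "Q f"
proof -
  interpret F: module R "free_module R X" by (rule free_module_module)
  have "finite {x. f x \<noteq> \<zero>}" using assms(1) by (simp add: free_module_simps)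
  then show ?thesis using assms(1)
  proof (induction "{x. f x \<noteq> \<zero>}" arbitrary: f rule: finite_induct)
    case empty
    then have "f = \<zero>\<^bsub>free_module R X\<^esub>" by (auto simp: free_module_simps)
    then show ?case using zero by simp
  next
    case (insert x B)
    let ?g = "f(x := \<zero>)"
    have x: "x \<in> X" "f x \<in> carrier R"
      using insert.hyps(4) insert.prems by (auto simp: free_module_simps)
    have B: "B = {y. ?g y \<noteq> \<zero>}" using insert.hyps by auto
    have g: "?g \<in> carrier (free_module R X)"
      using insert.prems insert.hyps(1) B by (auto simp: free_module_simps)
    have e: "f = ?g \<oplus>\<^bsub>free_module R X\<^esub> (f x \<odot>\<^bsub>free_module R X\<^esub> free_gen R x)"
      using insert.prems by (auto simp: free_module_simps free_gen_def fun_eq_iff)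
    show ?case
      by (subst e) (intro add g F.smult_closed free_gen_carrier x insert.hyps(3)[OF B] smult gen)
  qed
qed

lemma free_module_lift:
  assumes "module R N" "\<And>x. x \<in> X \<Longrightarrow> \<phi> x \<in> carrier N"
  shows "\<exists>F\<in>linear_maps R (free_module R X) N. \<forall>x\<in>X. F (free_gen R x) = \<phi> x"
proof -
  interpret N: module R N by fact
  \<comment> \<open>Outside \<open>X\<close> nothing is known about \<open>\<phi>\<close>, so points
    there contribute zero.\<close>
  define h where "h x c = (if x \<in> X then c \<odot>\<^bsub>N\<^esub> \<phi> x else \<zero>\<^bsub>N\<^esub>)" for x c
  define F where "F f = finsum N (\<lambda>x. h x (f x)) {x. f x \<noteq> \<zero>}" for f
  define C where "C x = (if x \<in> X then carrier R else {\<zero>})" for x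
  have C: "f x \<in> C x" if "f \<in> carrier (free_module R X)" for f x
    using that by (auto simp: free_module_simps C_def)
  have h: "c \<in> C x \<Longrightarrow> h x c \<in> carrier N" "h x \<zero> = \<zero>\<^bsub>N\<^esub>" for x c
    using assms(2) by (auto simp: h_def C_def)
  show ?thesis
  proof (intro bexI ballI)
    show "F \<in> linear_maps R (free_module R X) N"
    proof (rule linear_mapsI)
      fix f assume f: "f \<in> carrier (free_module R X)"
      show "F f \<in> carrier N" unfolding F_def using C[OF f] h by (intro N.M.finsum_closed) auto
      fix g assume g: "g \<in> carrier (free_module R X)"
      show "F (f \<oplus>\<^bsub>free_module R X\<^esub> g) = F f \<oplus>\<^bsub>N\<^esub> F g"
        unfolding F_def free_module_simps
        by (rule N.M.finsum_support_add[where C = C and h = h and ad = "\<lambda>i. add R"])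
          (use C[OF f] C[OF g] h f g assms(2) in \<open>auto simp: C_def h_def free_module_simps N.smult_l_distr\<close>)
    next
      fix c f assume c: "c \<in> carrier R" and f: "f \<in> carrier (free_module R X)"
      show "F (c \<odot>\<^bsub>free_module R X\<^esub> f) = c \<odot>\<^bsub>N\<^esub> F f"
        unfolding F_def free_module_simps
        by (rule N.finsum_support_smult[where C = C and h = h and sm = "\<lambda>i x. c \<otimes> x"])
          (use C[OF f] h f c assms(2) in \<open>auto simp: C_def h_def free_module_simps N.smult_assoc1\<close>)
    qed
    fix x assume x: "x \<in> X"
    show "F (free_gen R x) = \<phi> x"
    proof (cases "\<one> = \<zero>")
      \<comment> \<open>Over the zero ring a generator has empty support, so the sum for
        \<open>F\<close> is zero; this is right because every module is then trivial.\<close>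
      case True
      have "y = \<zero>\<^bsub>N\<^esub>" if "y \<in> carrier N" for y
        using N.smult_one[OF that] N.smult_l_null[OF that] True by simp
      then show ?thesis using assms(2)[OF x] True by (simp add: F_def free_gen_def)
    next
      case False
      then have "{y. free_gen R x y \<noteq> \<zero>} = {x}" by (auto simp: free_gen_def)
      then show ?thesis using x assms(2)[OF x]
        by (simp add: F_def h_def free_gen_def Pi_def)
    qed
  qed
qed

end

section \<open>Quotient modules and submodule spans\<close>

lemma quotient_module_simps:
  "carrier (quotient_module M N) = a_rcosets\<^bsub>M\<^esub> N"
  "\<zero>\<^bsub>quotient_module M N\<^esub> = N"
  "X \<oplus>\<^bsub>quotient_module M N\<^esub> Y = set_add M X Y"
  "c \<odot>\<^bsub>quotient_module M N\<^esub> X = (\<Union>x\<in>X. N +>\<^bsub>M\<^esub> (c \<odot>\<^bsub>M\<^esub> x))"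
  by (simp_all add: quotient_module_def)

context module
begin

lemma submodule_abelian_subgroup: "submodule N R M \<Longrightarrow> abelian_subgroup N M"
  by (intro abelian_subgroupI3 additive_subgroup.intro)
    (auto simp: submodule_def M.abelian_group_axioms)

lemma quotient_module_carrier:
  "carrier (quotient_module M N) = (\<lambda>x. N +>\<^bsub>M\<^esub> x) ` carrier M"
  by (auto simp: quotient_module_simps A_RCOSETS_def')

lemma quotient_module_add:
  assumes "submodule N R M" "x \<in> carrier M" "y \<in> carrier M"
  shows "(N +>\<^bsub>M\<^esub> x) \<oplus>\<^bsub>quotient_module M N\<^esub> (N +>\<^bsub>M\<^esub> y) = N +>\<^bsub>M\<^esub> (x \<oplus>\<^bsub>M\<^esub> y)"
  using abelian_subgroup.a_rcos_sum[OF submodule_abelian_subgroup[OF assms(1)] assms(2,3)]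
  by (simp add: quotient_module_simps)

lemma coset_eq_iff:
  assumes N: "submodule N R M" and x: "x \<in> carrier M" and y: "y \<in> carrier M"
  shows "N +>\<^bsub>M\<^esub> x = N +>\<^bsub>M\<^esub> y \<longleftrightarrow> x \<ominus>\<^bsub>M\<^esub> y \<in> N"
proof -
  interpret N: abelian_subgroup N M by (rule submodule_abelian_subgroup[OF N])
  have "N +>\<^bsub>M\<^esub> x = N +>\<^bsub>M\<^esub> y \<longleftrightarrow> x \<in> N +>\<^bsub>M\<^esub> y"
    using N.a_repr_independence'[OF _ y] N.a_rcos_self[OF x] by metis
  then show ?thesis using N.a_rcos_module[OF y x] by (simp add: a_minus_def)
qed

text \<open>The scalar action on a coset is a union over all of its representatives. It is a single
  coset because representatives differ by an element of \<open>N\<close>, and \<open>N\<close> is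
  closed under scalars.\<close>

lemma quotient_module_smult:
  assumes N: "submodule N R M" and c: "c \<in> carrier R" and x: "x \<in> carrier M"
  shows "c \<odot>\<^bsub>quotient_module M N\<^esub> (N +>\<^bsub>M\<^esub> x) = N +>\<^bsub>M\<^esub> (c \<odot>\<^bsub>M\<^esub> x)"
proof -
  interpret N: abelian_subgroup N M by (rule submodule_abelian_subgroup[OF N])
  have "N +>\<^bsub>M\<^esub> (c \<odot>\<^bsub>M\<^esub> y) = N +>\<^bsub>M\<^esub> (c \<odot>\<^bsub>M\<^esub> x)" if y: "y \<in> N +>\<^bsub>M\<^esub> x" for y
  proof -
    have yc: "y \<in> carrier M" using y x M.a_r_coset_subset_G[OF N.a_subset x] by blast
    have "N +>\<^bsub>M\<^esub> y = N +>\<^bsub>M\<^esub> x" using N.a_repr_independence'[OF y x] by simp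
    then have "y \<ominus>\<^bsub>M\<^esub> x \<in> N" using coset_eq_iff[OF N yc x] by simp
    then have "c \<odot>\<^bsub>M\<^esub> (y \<ominus>\<^bsub>M\<^esub> x) \<in> N" using submodule.smult_closed[OF N c] by simp
    then have "(c \<odot>\<^bsub>M\<^esub> y) \<ominus>\<^bsub>M\<^esub> (c \<odot>\<^bsub>M\<^esub> x) \<in> N"
      using c x yc by (simp add: a_minus_def smult_r_distr smult_r_minus)
    then show ?thesis using coset_eq_iff[OF N] c x yc by simp
  qed
  moreover have "x \<in> N +>\<^bsub>M\<^esub> x" using N.a_rcos_self[OF x] .
  ultimately show ?thesis unfolding quotient_module_simps by blast
qed

lemma quotient_module_module:
  assumes N: "submodule N R M"
  shows "module R (quotient_module M N)"
proof -
  interpret N: abelian_subgroup N M by (rule submodule_abelian_subgroup[OF N])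
  have z: "\<zero>\<^bsub>quotient_module M N\<^esub> = N +>\<^bsub>M\<^esub> \<zero>\<^bsub>M\<^esub>"
    using N.a_subset by (simp add: quotient_module_simps)
  note s = quotient_module_carrier quotient_module_add[OF N] quotient_module_smult[OF N]
  show ?thesis
  proof (rule moduleI)
    show "abelian_group (quotient_module M N)"
    proof (rule abelian_groupI)
      fix X assume "X \<in> carrier (quotient_module M N)"
      then obtain x where x: "x \<in> carrier M" "X = N +>\<^bsub>M\<^esub> x" by (auto simp: s)
      then have "(N +>\<^bsub>M\<^esub> (\<ominus>\<^bsub>M\<^esub> x)) \<oplus>\<^bsub>quotient_module M N\<^esub> X = \<zero>\<^bsub>quotient_module M N\<^esub>"
        by (simp add: s z M.l_neg)
      then show "\<exists>Y\<in>carrier (quotient_module M N). Y \<oplus>\<^bsub>quotient_module M N\<^esub> X = \<zero>\<^bsub>quotient_module M N\<^esub>"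
        using x by (auto simp: s)
    qed (unfold z, auto simp: s M.a_ac)
  qed (auto simp: s R.is_cring smult_l_distr smult_r_distr smult_assoc1)
qed

lemma coset_map_linear:
  assumes N: "submodule N R M"
  shows "(\<lambda>x. N +>\<^bsub>M\<^esub> x) \<in> linear_maps R M (quotient_module M N)"
  by (rule linear_mapsI)
    (auto simp: quotient_module_carrier quotient_module_add[OF N] quotient_module_smult[OF N])

lemma quotient_module_lift:
  assumes N: "submodule N R M" and L: "module R L"
    and f: "f \<in> linear_maps R M L" "\<And>x. x \<in> N \<Longrightarrow> f x = \<zero>\<^bsub>L\<^esub>"
  shows "\<exists>F\<in>linear_maps R (quotient_module M N) L. \<forall>x\<in>carrier M. F (N +>\<^bsub>M\<^esub> x) = f x"
proof -
  interpret L: module R L by fact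
  note s = quotient_module_carrier quotient_module_add[OF N] quotient_module_smult[OF N]
  \<comment> \<open>Evaluate at some representative; two representatives differ by an element of
    \<open>N\<close>, which \<open>f\<close> kills.\<close>
  define F where "F X = f (SOME x. x \<in> carrier M \<and> X = N +>\<^bsub>M\<^esub> x)" for X
  have F: "F (N +>\<^bsub>M\<^esub> x) = f x" if x: "x \<in> carrier M" for x
  proof -
    define y where "y = (SOME y. y \<in> carrier M \<and> N +>\<^bsub>M\<^esub> x = N +>\<^bsub>M\<^esub> y)"
    have y: "y \<in> carrier M \<and> N +>\<^bsub>M\<^esub> x = N +>\<^bsub>M\<^esub> y"
      unfolding y_def by (rule someI) (use x in auto)
    then have "x \<ominus>\<^bsub>M\<^esub> y \<in> N" using coset_eq_iff[OF N x] by blast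
    then have "f x \<ominus>\<^bsub>L\<^esub> f y = \<zero>\<^bsub>L\<^esub>"
      using f(2) linear_maps_minus[OF module_axioms L f(1) x] y by metis
    then have "f x = f y" using linear_mapsD(1)[OF f(1)] x y L.M.minus_eq_zero_iff by simp
    then show ?thesis unfolding F_def y_def by simp
  qed
  show ?thesis
  proof (intro bexI ballI)
    show "F \<in> linear_maps R (quotient_module M N) L"
      by (rule linear_mapsI) (auto simp: s F linear_mapsD[OF f(1)])
  qed (fact F)
qed

lemma submodule_span_submodule:
  assumes "B \<subseteq> carrier M"
  shows "submodule (submodule_span R M B) R M"
proof (rule submoduleI)
  \<comment> \<open>The whole module contains \<open>B\<close>, hence is one of the submodules being
    intersected; this bounds the span by the carrier.\<close>
  show "submodule_span R M B \<subseteq> carrier M"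
    using assms carrier_is_submodule by (auto simp: submodule_span_def)
qed (auto simp: submodule_span_def subgroup.m_closed[OF submodule.axioms(1)] submodule.smult_closed
    submoduleE(3,5) dest: subgroup.one_closed[OF submodule.axioms(1)])

lemma submodule_span_superset: "B \<subseteq> submodule_span R M B"
  by (auto simp: submodule_span_def)

lemma submodule_span_least: "submodule N R M \<Longrightarrow> B \<subseteq> N \<Longrightarrow> submodule_span R M B \<subseteq> N"
  by (auto simp: submodule_span_def)

end

section \<open>Direct sums and their universal property\<close>

lemma direct_sum_simps:
  "carrier (direct_sum T) = {x. (\<forall>i. x i \<in> carrier (T i)) \<and> finite {i. x i \<noteq> \<zero>\<^bsub>T i\<^esub>}}"
  "\<zero>\<^bsub>direct_sum T\<^esub> = (\<lambda>i. \<zero>\<^bsub>T i\<^esub>)"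
  "x \<oplus>\<^bsub>direct_sum T\<^esub> y = (\<lambda>i. x i \<oplus>\<^bsub>T i\<^esub> y i)"
  "c \<odot>\<^bsub>direct_sum T\<^esub> x = (\<lambda>i. c \<odot>\<^bsub>T i\<^esub> x i)"
  by (simp_all add: direct_sum_def)

definition direct_inj :: "('i \<Rightarrow> ('k, 'a, 'n) module_scheme) \<Rightarrow> 'i \<Rightarrow> 'a \<Rightarrow> 'i \<Rightarrow> 'a"
  where "direct_inj T i x = (\<lambda>j. if j = i then x else \<zero>\<^bsub>T j\<^esub>)"

locale module_family = cring K for K :: "('k, 'm) ring_scheme" (structure) +
  fixes T :: "'i \<Rightarrow> ('k, 'a, 'n) module_scheme"
  assumes T_module: "module K (T i)"
begin

sublocale T: module K "T i" for i by (rule T_module)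

lemma direct_sum_module: "module K (direct_sum T)"
proof (rule moduleI)
  have add: "x \<oplus>\<^bsub>direct_sum T\<^esub> y \<in> carrier (direct_sum T)"
    if "x \<in> carrier (direct_sum T)" "y \<in> carrier (direct_sum T)" for x y
  proof -
    have "{i. x i \<oplus>\<^bsub>T i\<^esub> y i \<noteq> \<zero>\<^bsub>T i\<^esub>} \<subseteq> {i. x i \<noteq> \<zero>\<^bsub>T i\<^esub>} \<union> {i. y i \<noteq> \<zero>\<^bsub>T i\<^esub>}"
      using that by auto
    then show ?thesis using that by (auto simp: direct_sum_simps intro: finite_subset)
  qed
  have smult: "c \<odot>\<^bsub>direct_sum T\<^esub> x \<in> carrier (direct_sum T)"
    if "c \<in> carrier K" "x \<in> carrier (direct_sum T)" for x c
  proof -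
    have "{i. c \<odot>\<^bsub>T i\<^esub> x i \<noteq> \<zero>\<^bsub>T i\<^esub>} \<subseteq> {i. x i \<noteq> \<zero>\<^bsub>T i\<^esub>}" using that by auto
    then show ?thesis using that by (auto simp: direct_sum_simps intro: finite_subset)
  qed
  show "abelian_group (direct_sum T)"
  proof (rule abelian_groupI)
    fix x assume x: "x \<in> carrier (direct_sum T)"
    have "(\<ominus> \<one>) \<odot>\<^bsub>direct_sum T\<^esub> x \<oplus>\<^bsub>direct_sum T\<^esub> x = \<zero>\<^bsub>direct_sum T\<^esub>"
      using x by (auto simp: direct_sum_simps T.smult_l_minus T.M.l_neg)
    then show "\<exists>y\<in>carrier (direct_sum T). y \<oplus>\<^bsub>direct_sum T\<^esub> x = \<zero>\<^bsub>direct_sum T\<^esub>"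
      using smult x by (metis a_inv_closed one_closed)
  qed (use add in \<open>auto simp: direct_sum_simps T.M.a_ac\<close>)
  show "c \<odot>\<^bsub>direct_sum T\<^esub> x \<in> carrier (direct_sum T)"
    if "c \<in> carrier K" "x \<in> carrier (direct_sum T)" for c x
    using smult that .
qed (auto simp: direct_sum_simps T.smult_l_distr T.smult_r_distr T.smult_assoc1 is_cring)

lemma direct_inj_linear: "direct_inj T i \<in> linear_maps K (T i) (direct_sum T)"
  by (rule linear_mapsI) (auto simp: direct_sum_simps direct_inj_def fun_eq_iff)

text \<open>Splits off one component at a time. A component is an arbitrary element of
  \<open>T i\<close>, so scalar multiples are absorbed in it.\<close>

lemma direct_sum_induct [consumes 1, case_names zero inj add]:
  assumes "x \<in> carrier (direct_sum T)"
    and zero: "Q \<zero>\<^bsub>direct_sum T\<^esub>"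
    and inj: "\<And>i y. y \<in> carrier (T i) \<Longrightarrow> Q (direct_inj T i y)"
    and add: "\<And>x y. x \<in> carrier (direct_sum T) \<Longrightarrow> y \<in> carrier (direct_sum T) \<Longrightarrow>
      Q x \<Longrightarrow> Q y \<Longrightarrow> Q (x \<oplus>\<^bsub>direct_sum T\<^esub> y)"
  shows "Q x"
proof -
  have "finite {i. x i \<noteq> \<zero>\<^bsub>T i\<^esub>}" using assms(1) by (simp add: direct_sum_simps)
  then show ?thesis using assms(1)
  proof (induction "{i. x i \<noteq> \<zero>\<^bsub>T i\<^esub>}" arbitrary: x rule: finite_induct)
    case empty
    then have "x = \<zero>\<^bsub>direct_sum T\<^esub>" by (auto simp: direct_sum_simps)
    then show ?case using zero by simp
  next
    case (insert i B)
    let ?y = "x(i := \<zero>\<^bsub>T i\<^esub>)"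
    have i: "x i \<in> carrier (T i)" using insert.prems by (auto simp: direct_sum_simps)
    have B: "B = {j. ?y j \<noteq> \<zero>\<^bsub>T j\<^esub>}" using insert.hyps by auto
    have y: "?y \<in> carrier (direct_sum T)"
      using insert.prems insert.hyps(1) B by (auto simp: direct_sum_simps)
    have e: "x = ?y \<oplus>\<^bsub>direct_sum T\<^esub> direct_inj T i (x i)"
      using insert.prems by (auto simp: direct_sum_simps direct_inj_def fun_eq_iff)
    show ?case
      by (subst e) (intro add y linear_mapsD(1)[OF direct_inj_linear] i insert.hyps(3)[OF B] inj)
  qed
qed

lemma direct_sum_lift:
  assumes N: "module K N" and g: "\<And>i. g i \<in> linear_maps K (T i) N"
  shows "\<exists>F\<in>linear_maps K (direct_sum T) N. \<forall>i. \<forall>y\<in>carrier (T i). F (direct_inj T i y) = g i y"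
proof -
  interpret N: module K N by fact
  note g0 = linear_maps_zero[OF T_module N g]
  define F where "F x = finsum N (\<lambda>i. g i (x i)) {i. x i \<noteq> \<zero>\<^bsub>T i\<^esub>}" for x
  show ?thesis
  proof (intro bexI allI ballI)
    show "F \<in> linear_maps K (direct_sum T) N"
    proof (rule linear_mapsI)
      fix x assume x: "x \<in> carrier (direct_sum T)"
      show "F x \<in> carrier N" unfolding F_def using x linear_mapsD(1)[OF g]
        by (intro N.M.finsum_closed) (auto simp: direct_sum_simps)
      fix y assume y: "y \<in> carrier (direct_sum T)"
      show "F (x \<oplus>\<^bsub>direct_sum T\<^esub> y) = F x \<oplus>\<^bsub>N\<^esub> F y"
        unfolding F_def direct_sum_simps
        by (rule N.M.finsum_support_add[where C = "\<lambda>i. carrier (T i)" and h = g and ad = "\<lambda>i. add (T i)"])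
          (use x y g0 linear_mapsD[OF g] in \<open>auto simp: direct_sum_simps\<close>)
    next
      fix c x assume c: "c \<in> carrier K" and x: "x \<in> carrier (direct_sum T)"
      show "F (c \<odot>\<^bsub>direct_sum T\<^esub> x) = c \<odot>\<^bsub>N\<^esub> F x"
        unfolding F_def direct_sum_simps
        by (rule N.finsum_support_smult[where C = "\<lambda>i. carrier (T i)" and h = g and sm = "\<lambda>i x. c \<odot>\<^bsub>T i\<^esub> x"])
          (use x c g0 linear_mapsD[OF g] in \<open>auto simp: direct_sum_simps\<close>)
    qed
    fix i y assume y: "y \<in> carrier (T i)"
    show "F (direct_inj T i y) = g i y"
    proof (cases "y = \<zero>\<^bsub>T i\<^esub>")
      \<comment> \<open>Injecting zero gives empty support rather than \<open>{i}\<close>, so the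
        sum has no term at all and the value must be compared with \<open>g i\<close> at
        zero.\<close>
      case True
      then have "{j. direct_inj T i y j \<noteq> \<zero>\<^bsub>T j\<^esub>} = {}" by (auto simp: direct_inj_def)
      then show ?thesis using True g0 by (simp add: F_def)
    next
      case False
      then have "{j. direct_inj T i y j \<noteq> \<zero>\<^bsub>T j\<^esub>} = {i}" by (auto simp: direct_inj_def)
      then show ?thesis using linear_mapsD(1)[OF g y]
        by (simp add: F_def direct_inj_def Pi_def)
    qed
  qed
qed

end

section \<open>The universal property of \<open>Sh\<^sup>+(A)\<close>\<close>

text \<open>Ranges over words of all lengths at once: such a \<open>\<phi>\<close> is a family of
  multilinear maps, one for each tensor degree, which is what determines a linear map on
  \<open>Sh_plus\<close>.\<close>

definition multilinear ::
  "('k, 'm) ring_scheme \<Rightarrow> ('k, 'a, 'n) module_scheme \<Rightarrow> ('k, 'b, 'p) module_scheme \<Rightarrow> ('a list \<Rightarrow> 'b) \<Rightarrow> bool"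
  where "multilinear K A N \<phi> \<longleftrightarrow>
    (\<forall>w\<in>lists (carrier A). \<phi> w \<in> carrier N) \<and>
    (\<forall>u\<in>lists (carrier A). \<forall>v\<in>lists (carrier A).
      (\<lambda>x. \<phi> (u @ x # v)) \<in> linear_maps K A N)"

lemma multilinearD:
  assumes "multilinear K A N \<phi>"
  shows "w \<in> lists (carrier A) \<Longrightarrow> \<phi> w \<in> carrier N"
    and "u \<in> lists (carrier A) \<Longrightarrow> v \<in> lists (carrier A) \<Longrightarrow>
      (\<lambda>x. \<phi> (u @ x # v)) \<in> linear_maps K A N"
  using assms by (auto simp: multilinear_def)

text \<open>The slot that varies is either the first letter or lies behind a fixed first
  letter.\<close>

lemma multilinear_ConsI:
  assumes "\<phi> [] \<in> carrier N"
    and "\<And>a. a \<in> carrier A \<Longrightarrow> multilinear K A N (\<lambda>w. \<phi> (a # w))"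
    and "\<And>w. w \<in> lists (carrier A) \<Longrightarrow> (\<lambda>x. \<phi> (x # w)) \<in> linear_maps K A N"
  shows "multilinear K A N \<phi>"
  unfolding multilinear_def
proof (intro conjI ballI)
  fix w assume "w \<in> lists (carrier A)"
  then show "\<phi> w \<in> carrier N"
    using assms(1) multilinearD(1)[OF assms(2)] by (cases w) auto
next
  fix u v assume "u \<in> lists (carrier A)" "v \<in> lists (carrier A)"
  then show "(\<lambda>x. \<phi> (u @ x # v)) \<in> linear_maps K A N"
    using assms(3) multilinearD(2)[OF assms(2)] by (cases u) auto
qed

lemma multilinear_comp:
  assumes "multilinear K A M \<phi>" "f \<in> linear_maps K M N"
  shows "multilinear K A N (\<lambda>w. f (\<phi> w))"
  using assms linear_maps_comp[of _ K A M f N] linear_mapsD(1)[OF assms(2)]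
  unfolding multilinear_def by auto

lemma multilinear_null:
  assumes "module K N"
  shows "multilinear K A N (\<lambda>w. \<zero>\<^bsub>N\<^esub>)"
proof -
  interpret N: module K N by fact
  show ?thesis using linear_maps_null[OF assms] by (auto simp: multilinear_def)
qed

locale tensor_setup = algebra K A
  for K :: "('k, 'm) ring_scheme" and A :: "('k, 'a, 'n) module_scheme"
begin

abbreviation "W \<equiv> word_module K A"
abbreviation "S \<equiv> Sh_plus K A"
abbreviation "p \<equiv> pure_tensor K A"
abbreviation "words \<equiv> lists (carrier A)"

sublocale W: module K "W n" for n
  unfolding word_module_def by (rule R.free_module_module)

lemma free_gen_word: "w \<in> words \<Longrightarrow> free_gen K w \<in> carrier (W (length w))"
  unfolding word_module_def by (rule R.free_gen_carrier) (auto simp: tensor_words_def)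

lemma free_gen_word': "w \<in> words \<Longrightarrow> length w = n \<Longrightarrow> free_gen K w \<in> carrier (W n)"
  using free_gen_word by blast

lemma tensor_relations_carrier: "tensor_relations K A n \<subseteq> carrier (W n)"
proof
  have c: "free_gen K (u @ x # v) \<in> carrier (W n)"
    if "set u \<subseteq> carrier A" "set v \<subseteq> carrier A" "x \<in> carrier A" "length u + 1 + length v = n" for u x v
    using that by (intro free_gen_word') auto
  fix r assume "r \<in> tensor_relations K A n"
  then show "r \<in> carrier (W n)"
    unfolding tensor_relations_def
    by (elim UnE CollectE exE conjE) (simp_all add: c)
qed

lemma tensor_null_submodule: "submodule (tensor_null K A n) K (W n)"
  unfolding tensor_null_def by (rule W.submodule_span_submodule[OF tensor_relations_carrier])

lemma tensor_relation_null: "x \<in> tensor_relations K A n \<Longrightarrow> x \<in> tensor_null K A n"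
  unfolding tensor_null_def using W.submodule_span_superset by blast

sublocale T: module_family K "tensor_power K A"
  by (intro module_family.intro module_family_axioms.intro R.cring_axioms)
    (unfold tensor_power_def, rule W.quotient_module_module[OF tensor_null_submodule])

sublocale S: module K S
  unfolding Sh_plus_def by (rule T.direct_sum_module)

definition tensor_class :: "nat \<Rightarrow> ('a list \<Rightarrow> 'k) \<Rightarrow> ('a list \<Rightarrow> 'k) set"
  where "tensor_class n x = tensor_null K A n +>\<^bsub>W n\<^esub> x"

lemma tensor_class_linear: "tensor_class n \<in> linear_maps K (W n) (tensor_power K A n)"
  unfolding tensor_class_def[abs_def] tensor_power_def
  by (rule W.coset_map_linear[OF tensor_null_submodule])

lemma pure_tensor_inj:
  "p w = direct_inj (tensor_power K A) (length w) (tensor_class (length w) (free_gen K w))"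
  by (rule ext) (simp add: pure_tensor_def direct_inj_def tensor_class_def)

text \<open>Unlike \<open>p\<close>, this is defined on combinations of words of length
  \<open>n\<close> and is linear there, so the relations can be pushed through it.\<close>

definition word_embed :: "nat \<Rightarrow> ('a list \<Rightarrow> 'k) \<Rightarrow> ('k, 'a) tensors"
  where "word_embed n x = direct_inj (tensor_power K A) n (tensor_class n x)"

lemma word_embed_linear: "word_embed n \<in> linear_maps K (W n) S"
  unfolding word_embed_def[abs_def] Sh_plus_def
  by (rule linear_maps_comp[OF tensor_class_linear T.direct_inj_linear])

lemma pure_tensor_word_embed: "length w = n \<Longrightarrow> p w = word_embed n (free_gen K w)"
  by (auto simp: pure_tensor_inj word_embed_def)

lemma p_closed [simp, intro]: "w \<in> words \<Longrightarrow> p w \<in> carrier S"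
  by (simp add: pure_tensor_word_embed linear_mapsD(1)[OF word_embed_linear] free_gen_word)

lemma word_embed_null:
  assumes "x \<in> tensor_null K A n"
  shows "word_embed n x = \<zero>\<^bsub>S\<^esub>"
proof -
  have x: "x \<in> carrier (W n)"
    using assms W.submoduleE(1)[OF tensor_null_submodule] by blast
  have "tensor_class n x = \<zero>\<^bsub>tensor_power K A n\<^esub>"
    unfolding tensor_class_def tensor_power_def quotient_module_simps
    by (rule W.M.a_coset_join2[OF x submodule.axioms(1)[OF tensor_null_submodule] assms])
  then show ?thesis
    by (simp add: word_embed_def direct_inj_def Sh_plus_def direct_sum_simps fun_eq_iff)
qed

text \<open>Both families of generators of \<open>tensor_null\<close> state linearity in one slot;
  \<open>word_embed\<close> sends them to zero and, being linear, turns them into equations between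
  pure tensors.\<close>

lemma p_multilinear: "multilinear K A S p"
  unfolding multilinear_def
proof (intro conjI ballI linear_mapsI)
  fix u v assume u: "u \<in> words" and v: "v \<in> words"
  define n where "n = length u + 1 + length v"
  have pe: "p (u @ x # v) = word_embed n (free_gen K (u @ x # v))" for x
    by (rule pure_tensor_word_embed) (simp add: n_def)
  have fc: "free_gen K (u @ x # v) \<in> carrier (W n)" if "x \<in> carrier A" for x
    using u v that by (intro free_gen_word') (auto simp: n_def)
  note lin = linear_mapsD[OF word_embed_linear[of n]]
  {
    fix x assume x: "x \<in> carrier A"
    then show "p (u @ x # v) \<in> carrier S" using u v by auto
    fix y assume y: "y \<in> carrier A"
    have "free_gen K (u @ (x \<oplus>\<^bsub>A\<^esub> y) # v)
       \<ominus>\<^bsub>W n\<^esub> (free_gen K (u @ x # v) \<oplus>\<^bsub>W n\<^esub> free_gen K (u @ y # v)) \<in> tensor_null K A n"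
      by (rule tensor_relation_null, unfold tensor_relations_def, rule UnI1, rule CollectI,
          rule exI[of _ u], rule exI[of _ v], rule exI[of _ x], rule exI[of _ y])
        (use u v x y in \<open>auto simp: n_def\<close>)
    from word_embed_null[OF this]
    have "p (u @ (x \<oplus>\<^bsub>A\<^esub> y) # v) \<ominus>\<^bsub>S\<^esub> (p (u @ x # v) \<oplus>\<^bsub>S\<^esub> p (u @ y # v)) = \<zero>\<^bsub>S\<^esub>"
      using x y by (simp add: pe fc lin linear_maps_minus[OF W.module_axioms S.module_axioms word_embed_linear])
    then show "p (u @ (x \<oplus>\<^bsub>A\<^esub> y) # v) = p (u @ x # v) \<oplus>\<^bsub>S\<^esub> p (u @ y # v)"
      using u v x y S.M.minus_eq_zero_iff by simp
  next
    fix c x assume c: "c \<in> carrier K" and x: "x \<in> carrier A"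
    have "free_gen K (u @ (c \<odot>\<^bsub>A\<^esub> x) # v)
       \<ominus>\<^bsub>W n\<^esub> (c \<odot>\<^bsub>W n\<^esub> free_gen K (u @ x # v)) \<in> tensor_null K A n"
      by (rule tensor_relation_null, unfold tensor_relations_def, rule UnI2, rule CollectI,
          rule exI[of _ u], rule exI[of _ v], rule exI[of _ c], rule exI[of _ x])
        (use u v x c in \<open>auto simp: n_def\<close>)
    from word_embed_null[OF this]
    have "p (u @ (c \<odot>\<^bsub>A\<^esub> x) # v) \<ominus>\<^bsub>S\<^esub> (c \<odot>\<^bsub>S\<^esub> p (u @ x # v)) = \<zero>\<^bsub>S\<^esub>"
      using x c by (simp add: pe fc lin linear_maps_minus[OF W.module_axioms S.module_axioms word_embed_linear])
    then show "p (u @ (c \<odot>\<^bsub>A\<^esub> x) # v) = c \<odot>\<^bsub>S\<^esub> p (u @ x # v)"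
      using u v x c S.M.minus_eq_zero_iff by simp
  }
qed auto

lemma p_Cons_linear: "w \<in> words \<Longrightarrow> (\<lambda>x. p (x # w)) \<in> linear_maps K A S"
  using multilinearD(2)[OF p_multilinear, of "[]"] by simp

text \<open>A tensor is a finite sum of homogeneous components, and each component is the class of a
  combination of words, so the inductions for direct sums and for free modules combine.\<close>

lemma Sh_plus_induct [consumes 1, case_names zero pure add smult]:
  assumes "x \<in> carrier S"
    and zero: "Q \<zero>\<^bsub>S\<^esub>"
    and pure: "\<And>w. w \<in> words \<Longrightarrow> Q (p w)"
    and add: "\<And>x y. x \<in> carrier S \<Longrightarrow> y \<in> carrier S \<Longrightarrow> Q x \<Longrightarrow> Q y \<Longrightarrow> Q (x \<oplus>\<^bsub>S\<^esub> y)"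
    and smult: "\<And>c x. c \<in> carrier K \<Longrightarrow> x \<in> carrier S \<Longrightarrow> Q x \<Longrightarrow> Q (c \<odot>\<^bsub>S\<^esub> x)"
  shows "Q x"
proof -
  have emb: "Q (word_embed n f)" if "f \<in> carrier (W n)" for n f
    using that unfolding word_module_def
  proof (induction rule: R.free_module_induct)
    case zero
    then show ?case
      using linear_maps_zero[OF W.module_axioms S.module_axioms word_embed_linear] assms(2)
      unfolding word_module_def by simp
  next
    case (gen w)
    then show ?case using pure by (auto simp: tensor_words_def pure_tensor_word_embed)
  next
    case (add f g)
    then show ?case using assms(4) linear_mapsD[OF word_embed_linear[of n]]
      unfolding word_module_def by simp
  next
    case (smult c f)
    then show ?case using assms(5) linear_mapsD[OF word_embed_linear[of n]]
      unfolding word_module_def by simp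
  qed
  show ?thesis using assms(1) unfolding Sh_plus_def
  proof (induction rule: T.direct_sum_induct)
    case zero
    then show ?case using assms(2) by (simp add: Sh_plus_def)
  next
    case (inj i y)
    then obtain f where "f \<in> carrier (W i)" "y = tensor_class i f"
      by (auto simp: tensor_power_def W.quotient_module_carrier tensor_class_def)
    then show ?case using emb by (simp add: word_embed_def)
  next
    case (add x y)
    then show ?case using assms(4) by (simp add: Sh_plus_def)
  qed
qed

text \<open>In each degree the values on words extend linearly to the free module. Multilinearity of
  \<open>\<phi>\<close> says that the relations lie in the kernel, hence so does their span, and the
  extension descends to the tensor power. The degrees are joined by the universal property of the
  direct sum.\<close>

lemma Sh_plus_lift:
  assumes N: "module K N" and \<phi>: "multilinear K A N \<phi>"
  shows "\<exists>F\<in>linear_maps K S N. \<forall>w\<in>words. F (p w) = \<phi> w"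
proof -
  interpret N: module K N by fact
  have "\<exists>g. g \<in> linear_maps K (tensor_power K A n) N \<and>
      (\<forall>w\<in>words. length w = n \<longrightarrow> g (tensor_class n (free_gen K w)) = \<phi> w)" for n
  proof -
    have \<phi>c: "\<And>w. w \<in> tensor_words A n \<Longrightarrow> \<phi> w \<in> carrier N"
      by (intro multilinearD(1)[OF \<phi>]) (auto simp: tensor_words_def)
    obtain F where F: "F \<in> linear_maps K (W n) N"
      and Fg: "\<And>w. w \<in> tensor_words A n \<Longrightarrow> F (free_gen K w) = \<phi> w"
      using R.free_module_lift[where X = "tensor_words A n" and \<phi> = \<phi>, OF N \<phi>c]
      unfolding word_module_def by blast
    note lin = linear_mapsD[OF F] linear_maps_minus[OF W.module_axioms N F]
    have Fw: "F (free_gen K (u @ x # v)) = \<phi> (u @ x # v)"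
      if "set u \<subseteq> carrier A" "set v \<subseteq> carrier A" "x \<in> carrier A" "length u + 1 + length v = n"
      for u x v
      using that by (intro Fg) (auto simp: tensor_words_def)
    have rel: "F r = \<zero>\<^bsub>N\<^esub>" if "r \<in> tensor_relations K A n" for r
      using that unfolding tensor_relations_def
    proof (elim UnE CollectE exE conjE)
      fix u v x y
      assume r: "r = free_gen K (u @ (x \<oplus>\<^bsub>A\<^esub> y) # v)
         \<ominus>\<^bsub>W n\<^esub> (free_gen K (u @ x # v) \<oplus>\<^bsub>W n\<^esub> free_gen K (u @ y # v))"
        and h: "set u \<subseteq> carrier A" "set v \<subseteq> carrier A" "x \<in> carrier A" "y \<in> carrier A"
          "length u + 1 + length v = n"
      have uv: "u \<in> words" "v \<in> words" using h by auto
      have c: "free_gen K (u @ z # v) \<in> carrier (W n)" if "z \<in> carrier A" for z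
        using h that by (intro free_gen_word') auto
      show "F r = \<zero>\<^bsub>N\<^esub>"
        using linear_mapsD[OF multilinearD(2)[OF \<phi> uv]] h
        by (simp add: r lin c Fw N.M.minus_eq_zero_iff)
    next
      fix u v d x
      assume r: "r = free_gen K (u @ (d \<odot>\<^bsub>A\<^esub> x) # v)
         \<ominus>\<^bsub>W n\<^esub> (d \<odot>\<^bsub>W n\<^esub> free_gen K (u @ x # v))"
        and h: "set u \<subseteq> carrier A" "set v \<subseteq> carrier A" "d \<in> carrier K" "x \<in> carrier A"
          "length u + 1 + length v = n"
      have uv: "u \<in> words" "v \<in> words" using h by auto
      have c: "free_gen K (u @ z # v) \<in> carrier (W n)" if "z \<in> carrier A" for z
        using h that by (intro free_gen_word') auto
      show "F r = \<zero>\<^bsub>N\<^esub>"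
        using linear_mapsD[OF multilinearD(2)[OF \<phi> uv]] h
        by (simp add: r lin c Fw N.M.minus_eq_zero_iff)
    qed
    have "tensor_null K A n \<subseteq> {x \<in> carrier (W n). F x = \<zero>\<^bsub>N\<^esub>}"
      unfolding tensor_null_def using rel tensor_relations_carrier
      by (intro W.submodule_span_least linear_kernel_submodule[OF W.module_axioms N F]) auto
    then have k: "\<And>x. x \<in> tensor_null K A n \<Longrightarrow> F x = \<zero>\<^bsub>N\<^esub>" by auto
    obtain g where "g \<in> linear_maps K (tensor_power K A n) N"
      "\<And>x. x \<in> carrier (W n) \<Longrightarrow> g (tensor_class n x) = F x"
      using W.quotient_module_lift[OF tensor_null_submodule N F k]
      unfolding tensor_power_def tensor_class_def by blast
    then show ?thesis using Fg
      by (intro exI[of _ g]) (auto simp: tensor_words_def free_gen_word')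
  qed
  then have "\<exists>g. \<forall>n. g n \<in> linear_maps K (tensor_power K A n) N \<and>
      (\<forall>w\<in>words. length w = n \<longrightarrow> g n (tensor_class n (free_gen K w)) = \<phi> w)"
    by (rule choice[OF allI])
  then obtain g where g: "\<And>n. g n \<in> linear_maps K (tensor_power K A n) N"
    and gw: "\<And>n w. w \<in> words \<Longrightarrow> length w = n \<Longrightarrow> g n (tensor_class n (free_gen K w)) = \<phi> w"
    by blast
  obtain F where F: "F \<in> linear_maps K (direct_sum (tensor_power K A)) N"
    and Fi: "\<And>i y. y \<in> carrier (tensor_power K A i) \<Longrightarrow> F (direct_inj (tensor_power K A) i y) = g i y"
    using T.direct_sum_lift[OF N g] by blast
  have "F (p w) = \<phi> w" if "w \<in> words" for w
    using that by (simp add: pure_tensor_inj Fi linear_mapsD(1)[OF tensor_class_linear] free_gen_word gw)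
  with F show ?thesis by (intro bexI[of _ F]) (simp_all add: Sh_plus_def)
qed

lemma Sh_plus_linear_eq:
  assumes "module K N" "f \<in> linear_maps K S N" "g \<in> linear_maps K S N"
    and "\<And>w. w \<in> words \<Longrightarrow> f (p w) = g (p w)" and "x \<in> carrier S"
  shows "f x = g x"
  using assms(5)
  by (induction rule: Sh_plus_induct)
    (simp_all add: assms(4) linear_maps_zero[OF S.module_axioms assms(1)] assms(2,3)
      linear_mapsD[OF assms(2)] linear_mapsD[OF assms(3)])

text \<open>The lifting property is applied in the second argument for a fixed word
  \<open>u\<close>, and after that in the first argument for a fixed tensor \<open>y\<close>. The
  lifts are chosen separately for each \<open>u\<close> and each \<open>y\<close>, so linearity in
  the other variable is not automatic; it is recovered by induction over tensors.\<close>

lemma Sh_plus_bilinear_lift: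
  assumes l: "\<And>v. v \<in> words \<Longrightarrow> multilinear K A S (\<lambda>u. \<phi> u v)"
    and r: "\<And>u. u \<in> words \<Longrightarrow> multilinear K A S (\<phi> u)"
  shows "\<exists>h. bilinear_op K S h \<and> (\<forall>u\<in>words. \<forall>v\<in>words. h (p u) (p v) = \<phi> u v)"
proof -
  have "\<forall>u\<in>words. \<exists>F. F \<in> linear_maps K S S \<and> (\<forall>w\<in>words. F (p w) = \<phi> u w)"
    using Sh_plus_lift[OF S.module_axioms r] by blast
  then have "\<exists>F. \<forall>u\<in>words. F u \<in> linear_maps K S S \<and> (\<forall>w\<in>words. F u (p w) = \<phi> u w)"
    by (rule bchoice)
  then obtain F where F: "\<And>u. u \<in> words \<Longrightarrow> F u \<in> linear_maps K S S"
    and Fp: "\<And>u v. u \<in> words \<Longrightarrow> v \<in> words \<Longrightarrow> F u (p v) = \<phi> u v"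
    by blast
  \<comment> \<open>If \<open>y\<close> is a pure tensor this is the hypothesis on
    \<open>\<phi>\<close>; linearity of each \<open>F u\<close> carries it to all tensors.\<close>
  have lin: "(\<lambda>x. F (u @ x # v) y) \<in> linear_maps K A S"
    if u: "u \<in> words" and v: "v \<in> words" and y: "y \<in> carrier S" for u v y
    using y
  proof (induction rule: Sh_plus_induct)
    case zero
    have "F (u @ x # v) \<zero>\<^bsub>S\<^esub> = \<zero>\<^bsub>S\<^esub>" if "x \<in> carrier A" for x
      using u v that by (intro linear_maps_zero[OF S.module_axioms S.module_axioms F]) auto
    then show ?case by (intro linear_mapsI) auto
  next
    case (pure w)
    have "F (u @ x # v) (p w) = \<phi> (u @ x # v) w" if "x \<in> carrier A" for x
      using u v that pure by (intro Fp) auto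
    then show ?case
      using linear_mapsD[OF multilinearD(2)[OF l[OF pure] u v]] by (intro linear_mapsI) auto
  next
    case (add y z)
    have "F (u @ x # v) (y \<oplus>\<^bsub>S\<^esub> z) = F (u @ x # v) y \<oplus>\<^bsub>S\<^esub> F (u @ x # v) z" if "x \<in> carrier A" for x
      using u v that add by (intro linear_mapsD(2)[OF F]) auto
    then show ?case
      using linear_mapsD[OF linear_maps_add[OF S.module_axioms add(3,4)]] by (intro linear_mapsI) auto
  next
    case (smult c y)
    have "F (u @ x # v) (c \<odot>\<^bsub>S\<^esub> y) = c \<odot>\<^bsub>S\<^esub> F (u @ x # v) y" if "x \<in> carrier A" for x
      using u v that smult by (intro linear_mapsD(3)[OF F]) auto
    then show ?case
      using linear_mapsD[OF linear_maps_smult[OF S.module_axioms smult(3,1)]] by (intro linear_mapsI) auto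
  qed
  have "multilinear K A S (\<lambda>u. F u y)" if "y \<in> carrier S" for y
    using that lin linear_mapsD(1)[OF F] by (auto simp: multilinear_def)
  then have "\<forall>y\<in>carrier S. \<exists>G. G \<in> linear_maps K S S \<and> (\<forall>u\<in>words. G (p u) = F u y)"
    using Sh_plus_lift[OF S.module_axioms] by blast
  then have "\<exists>G. \<forall>y\<in>carrier S. G y \<in> linear_maps K S S \<and> (\<forall>u\<in>words. G y (p u) = F u y)"
    by (rule bchoice)
  then obtain G where G: "\<And>y. y \<in> carrier S \<Longrightarrow> G y \<in> linear_maps K S S"
    and Gp: "\<And>u y. u \<in> words \<Longrightarrow> y \<in> carrier S \<Longrightarrow> G y (p u) = F u y"
    by blast
  \<comment> \<open>On a pure tensor \<open>p w\<close> the map is \<open>F w\<close>, which is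
    linear; a general \<open>x\<close> is reached through linearity of each
    \<open>G y\<close>.\<close>
  have lr: "(\<lambda>y. G y x) \<in> linear_maps K S S" if "x \<in> carrier S" for x
    using that
  proof (induction rule: Sh_plus_induct)
    case zero
    have "G y \<zero>\<^bsub>S\<^esub> = \<zero>\<^bsub>S\<^esub>" if "y \<in> carrier S" for y
      by (rule linear_maps_zero[OF S.module_axioms S.module_axioms G[OF that]])
    then show ?case by (intro linear_mapsI) auto
  next
    case (pure w)
    then show ?case using linear_mapsD[OF F[OF pure]] by (intro linear_mapsI) (auto simp: Gp)
  next
    case (add x z)
    then show ?case
      using linear_mapsD[OF linear_maps_add[OF S.module_axioms add(3,4)]]
      by (intro linear_mapsI) (auto simp: linear_mapsD(2)[OF G])
  next
    case (smult c x)
    then show ?case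
      using linear_mapsD[OF linear_maps_smult[OF S.module_axioms smult(3,1)]]
      by (intro linear_mapsI) (auto simp: linear_mapsD(3)[OF G])
  qed
  show ?thesis
  proof (intro exI conjI ballI)
    show "bilinear_op K S (\<lambda>x y. G y x)" using G lr by (auto simp: bilinear_op_def)
  qed (simp add: Gp Fp)
qed

lemma Sh_plus_bilinear_eq:
  assumes "bilinear_op K S f" "bilinear_op K S g"
    and "\<And>u v. u \<in> words \<Longrightarrow> v \<in> words \<Longrightarrow> f (p u) (p v) = g (p u) (p v)"
    and "x \<in> carrier S" "y \<in> carrier S"
  shows "f x y = g x y"
proof (rule Sh_plus_linear_eq[OF S.module_axioms bilinear_opD(1)[OF assms(1,4)] bilinear_opD(1)[OF assms(2,4)] _ assms(5)])
  fix w assume w: "w \<in> words"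
  show "f x (p w) = g x (p w)"
    by (rule Sh_plus_linear_eq[OF S.module_axioms, of "\<lambda>x. f x (p w)" "\<lambda>x. g x (p w)"])
      (use w assms bilinear_opD(2)[OF assms(1)] bilinear_opD(2)[OF assms(2)] in auto)
qed

abbreviation "t \<equiv> tensor_cons K A"

lemma multilinear_Cons:
  assumes "multilinear K A N \<phi>" "a \<in> carrier A"
  shows "multilinear K A N (\<lambda>w. \<phi> (a # w))"
  unfolding multilinear_def
proof (intro conjI ballI)
  show "\<phi> (a # w) \<in> carrier N" if "w \<in> words" for w
    using that assms(2) by (intro multilinearD(1)[OF assms(1)]) simp
  show "(\<lambda>x. \<phi> (a # u @ x # v)) \<in> linear_maps K A N" if "u \<in> words" "v \<in> words" for u v
    using multilinearD(2)[OF assms(1), of "a # u" v] that assms(2) by simp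
qed

text \<open>Licenses the definite description: the lifting property gives a linear map with these
  values, pure tensors determine it on the carrier, and \<open>extensional\<close> fixes it
  elsewhere.\<close>

lemma tensor_cons_characterization:
  assumes a: "a \<in> carrier A"
  shows "t a \<in> extensional (carrier S) \<and> t a \<in> linear_maps K S S \<and> (\<forall>w\<in>words. t a (p w) = p (a # w))"
proof -
  from Sh_plus_lift[OF S.module_axioms multilinear_Cons[OF p_multilinear a]] obtain F
    where F: "F \<in> linear_maps K S S" "\<And>w. w \<in> words \<Longrightarrow> F (p w) = p (a # w)" by blast
  have "\<exists>!f. f \<in> extensional (carrier S) \<and> f \<in> linear_maps K S S \<and> (\<forall>w\<in>words. f (p w) = p (a # w))"
  proof (rule ex1I)
    show "restrict F (carrier S) \<in> extensional (carrier S) \<and> restrict F (carrier S) \<in> linear_maps K S S \<and>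
        (\<forall>w\<in>words. restrict F (carrier S) (p w) = p (a # w))"
      using F linear_maps_restrict[OF S.module_axioms F(1)] by simp
    fix f assume f: "f \<in> extensional (carrier S) \<and> f \<in> linear_maps K S S \<and> (\<forall>w\<in>words. f (p w) = p (a # w))"
    show "f = restrict F (carrier S)"
    proof (rule extensionalityI[where A = "carrier S"])
      fix x assume "x \<in> carrier S"
      then show "f x = restrict F (carrier S) x"
        using Sh_plus_linear_eq[OF S.module_axioms _ F(1), of f x] f F(2) by simp
    qed (use f in auto)
  qed
  from theI'[OF this] show ?thesis unfolding tensor_cons_def .
qed

lemma t_linear: "a \<in> carrier A \<Longrightarrow> t a \<in> linear_maps K S S"
  using tensor_cons_characterization by blast

lemma t_pure: "a \<in> carrier A \<Longrightarrow> w \<in> words \<Longrightarrow> t a (p w) = p (a # w)"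
  using tensor_cons_characterization by blast

lemma t_closed [simp, intro]: "a \<in> carrier A \<Longrightarrow> x \<in> carrier S \<Longrightarrow> t a x \<in> carrier S"
  using linear_mapsD(1)[OF t_linear] .

lemmas t_add = linear_mapsD(2)[OF t_linear]
lemmas t_smult = linear_mapsD(3)[OF t_linear]
lemmas t_zero = linear_maps_zero[OF S.module_axioms S.module_axioms t_linear]
lemmas t_minus = linear_maps_minus[OF S.module_axioms S.module_axioms t_linear]

text \<open>Each \<open>t a\<close> comes from its own description, so the dependence on
  \<open>a\<close> is visible only on pure tensors, where it is the multilinearity of
  \<open>p\<close>.\<close>

lemma t_linear_left: "x \<in> carrier S \<Longrightarrow> (\<lambda>a. t a x) \<in> linear_maps K A S"
proof (induction rule: Sh_plus_induct)
  case zero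
  show ?case by (intro linear_mapsI) (auto simp: t_zero)
next
  case (pure w)
  show ?case using linear_mapsD[OF p_Cons_linear[OF pure]] by (intro linear_mapsI) (auto simp: t_pure pure)
next
  case (add x y)
  then show ?case
    using linear_mapsD[OF linear_maps_add[OF S.module_axioms add(3,4)]]
    by (intro linear_mapsI) (auto simp: t_add)
next
  case (smult c x)
  then show ?case
    using linear_mapsD[OF linear_maps_smult[OF S.module_axioms smult(3,1)]]
    by (intro linear_mapsI) (auto simp: t_smult)
qed

text \<open>The projection e, with values in \<open>S\<close> itself rather than in
  \<open>K\<close>, so that scalar parts can be added and multiplied like any tensor.\<close>

definition deg0 :: "('k, 'a) tensors \<Rightarrow> ('k, 'a) tensors"
  where "deg0 x = (\<lambda>n. if n = 0 then x n else \<zero>\<^bsub>tensor_power K A n\<^esub>)"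

lemma deg0_linear: "deg0 \<in> linear_maps K S S"
proof (rule linear_mapsI)
  fix x assume x: "x \<in> carrier S"
  have "{n. deg0 x n \<noteq> \<zero>\<^bsub>tensor_power K A n\<^esub>} \<subseteq> {n. x n \<noteq> \<zero>\<^bsub>tensor_power K A n\<^esub>}"
    by (auto simp: deg0_def)
  then show "deg0 x \<in> carrier S"
    using x by (auto simp: Sh_plus_def direct_sum_simps deg0_def intro: finite_subset)
qed (auto simp: deg0_def Sh_plus_def direct_sum_simps fun_eq_iff)

lemma deg0_closed [simp, intro]: "x \<in> carrier S \<Longrightarrow> deg0 x \<in> carrier S"
  using linear_mapsD(1)[OF deg0_linear] .

lemma deg0_eq_zero_iff: "deg0 x = \<zero>\<^bsub>S\<^esub> \<longleftrightarrow> x 0 = \<zero>\<^bsub>tensor_power K A 0\<^esub>"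
  by (auto simp: deg0_def Sh_plus_def direct_sum_simps fun_eq_iff)

lemma deg0_Nil [simp]: "deg0 (p []) = p []"
  by (auto simp: deg0_def pure_tensor_def fun_eq_iff)

lemma deg0_Cons [simp]: "deg0 (p (a # w)) = \<zero>\<^bsub>S\<^esub>"
  by (simp add: deg0_eq_zero_iff pure_tensor_def)

lemma deg0_t [simp]: 
  assumes "a \<in> carrier A" "x \<in> carrier S"
  shows "deg0 (t a x) = \<zero>\<^bsub>S\<^esub>"
  by (rule Sh_plus_linear_eq[OF S.module_axioms linear_maps_comp[OF t_linear deg0_linear]
        linear_maps_null[OF S.module_axioms]])
    (use assms in \<open>simp_all add: t_pure\<close>)

end

section \<open>The shuffle product\<close>

locale shuffle_setup = tensor_setup K A
  for K :: "('k, 'm) ring_scheme" and A :: "('k, 'a, 'n) module_scheme" +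
  fixes l :: 'k
  assumes l_closed [simp, intro]: "l \<in> carrier K"
begin

text \<open>No product occurs in it, so the recursion may use it before the product exists.\<close>

definition tau :: "('k, 'a) tensors \<Rightarrow> ('k, 'a) tensors"
  where "tau x = l \<odot>\<^bsub>S\<^esub> deg0 x \<ominus>\<^bsub>S\<^esub> t \<one>\<^bsub>A\<^esub> x"

lemma tau_linear: "tau \<in> linear_maps K S S"
  unfolding tau_def[abs_def]
  by (intro linear_maps_diff linear_maps_smult S.module_axioms deg0_linear t_linear l_closed one_closed)

lemma tau_closed [simp, intro]: "x \<in> carrier S \<Longrightarrow> tau x \<in> carrier S"
  using linear_mapsD(1)[OF tau_linear] .

lemma A_mult_linear: "a \<in> carrier A \<Longrightarrow> (\<lambda>x. a \<otimes>\<^bsub>A\<^esub> x) \<in> linear_maps K A A"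
  using smult_assoc2 by (intro linear_mapsI) (simp_all add: r_distr m_comm[of a])

text \<open>The result is a tensor rather than a word, so recursive results are passed only to the
  linear maps \<open>t\<close> and \<open>tau\<close>, and the arguments of recursive calls stay
  words.\<close>

fun word_shuffle :: "'a list \<Rightarrow> 'a list \<Rightarrow> ('k, 'a) tensors"
  where
    "word_shuffle [] v = p v"
  | "word_shuffle u [] = p u"
  | "word_shuffle (a # u) (b # v) = t a (word_shuffle u (b # v)) \<oplus>\<^bsub>S\<^esub> t b (word_shuffle (a # u) v)
      \<oplus>\<^bsub>S\<^esub> t (a \<otimes>\<^bsub>A\<^esub> b) (tau (word_shuffle u v))"

lemma word_shuffle_Nil_right [simp]: "word_shuffle u [] = p u"
  by (cases u) auto

lemma word_shuffle_closed [simp, intro]: "u \<in> words \<Longrightarrow> v \<in> words \<Longrightarrow> word_shuffle u v \<in> carrier S"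
  by (induction u v rule: word_shuffle.induct) auto

lemma word_shuffle_comm: "u \<in> words \<Longrightarrow> v \<in> words \<Longrightarrow> word_shuffle u v = word_shuffle v u"
  by (induction u v rule: word_shuffle.induct) (auto simp: S.M.a_ac m_comm)

text \<open>The outer induction is on \<open>u\<close>, the inner one on the prefix before the
  varying slot. When the slot comes first, its letter enters the three terms through the outer
  hypothesis, through the letter prefixed by \<open>t\<close>, and through the product with
  \<open>a\<close>. Behind a letter \<open>b\<close> the middle term needs the inner hypothesis,
  since it keeps all of \<open>a # u\<close>.\<close>

lemma word_shuffle_multilinear:
  assumes "u \<in> words"
  shows "multilinear K A S (word_shuffle u)"
  using assms
proof (induction u rule: list.induct)
  case Nil
  have "word_shuffle [] = p" by auto
  then show ?case using p_multilinear by simp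
next
  case (Cons a u)
  then have a: "a \<in> carrier A" and u: "u \<in> words" by auto
  note IH = multilinearD(2)[OF Cons.IH[OF u]]
  have "(\<lambda>x. word_shuffle (a # u) (v @ x # w)) \<in> linear_maps K A S" if "v \<in> words" "w \<in> words" for v w
    using that
  proof (induction v rule: list.induct)
    case Nil
    then have w: "w \<in> words" by simp
    have c: "word_shuffle (a # u) w \<in> carrier S" using a u w by (intro word_shuffle_closed) simp_all
    have "word_shuffle u w \<in> carrier S" using u w by (rule word_shuffle_closed)
    then show ?case using IH[of "[]" w] a w
      by (auto intro!: linear_maps_add linear_maps_comp[OF _ t_linear] S.module_axioms t_linear_left[OF c]
          linear_maps_comp[OF A_mult_linear t_linear_left])
  next
    case (Cons b v)
    then show ?case using IH[of "b # v" w] IH[of v w] a u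
      by (auto intro!: linear_maps_add linear_maps_comp[OF _ t_linear] S.module_axioms
          linear_maps_comp[OF _ tau_linear])
  qed
  then show ?case using Cons.prems by (auto simp: multilinear_def)
qed

text \<open>Being a choice, this extension is controlled only on the carrier of \<open>S\<close>, by
  bilinearity and its values on words.\<close>

definition mul :: "('k, 'a) tensors \<Rightarrow> ('k, 'a) tensors \<Rightarrow> ('k, 'a) tensors"  (infixl "\<star>" 70)
  where "mul = (SOME h. bilinear_op K S h \<and> (\<forall>u\<in>words. \<forall>v\<in>words. h (p u) (p v) = word_shuffle u v))"

lemma mul_bilinear: "bilinear_op K S mul"
  and mul_pure: "u \<in> words \<Longrightarrow> v \<in> words \<Longrightarrow> p u \<star> p v = word_shuffle u v"
proof -
  \<comment> \<open>Linearity in the letters of the first word follows from that in the second by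
    commutativity on words.\<close>
  have "multilinear K A S (\<lambda>u. word_shuffle u v)" if v: "v \<in> words" for v
    using word_shuffle_multilinear[OF v] v word_shuffle_comm[OF _ v] unfolding multilinear_def
    by (auto simp: linear_maps_def Pi_def)
  from someI_ex[OF Sh_plus_bilinear_lift[OF this word_shuffle_multilinear]]
  have "bilinear_op K S mul \<and> (\<forall>u\<in>words. \<forall>v\<in>words. mul (p u) (p v) = word_shuffle u v)"
    unfolding mul_def .
  then show "bilinear_op K S mul" "u \<in> words \<Longrightarrow> v \<in> words \<Longrightarrow> p u \<star> p v = word_shuffle u v" by auto
qed

lemma mul_closed [simp, intro]: "x \<in> carrier S \<Longrightarrow> y \<in> carrier S \<Longrightarrow> x \<star> y \<in> carrier S"
  using bilinear_opD(3)[OF mul_bilinear] .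

lemmas mul_smult_right = linear_mapsD(3)[OF bilinear_opD(1)[OF mul_bilinear]]
lemmas mul_add_left = linear_mapsD(2)[OF bilinear_opD(2)[OF mul_bilinear]]
lemmas mul_smult_left = linear_mapsD(3)[OF bilinear_opD(2)[OF mul_bilinear]]
lemmas mul_minus_left = linear_maps_minus[OF S.module_axioms S.module_axioms bilinear_opD(2)[OF mul_bilinear]]

lemma S_linear_id: "(\<lambda>x. x) \<in> linear_maps K S S"
  by (rule linear_mapsI) auto

text \<open>These rules discharge the side conditions when an identity is reduced to pure tensors in
  one argument: each side, as a function of that argument, is linear.\<close>

lemmas linear_intros = linear_maps_add[OF S.module_axioms] linear_maps_smult[OF S.module_axioms]
  linear_maps_null[OF S.module_axioms] linear_maps_diff[OF S.module_axioms] S_linear_id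
  linear_maps_comp[OF _ t_linear] linear_maps_comp[OF _ tau_linear] linear_maps_comp[OF _ deg0_linear]
  linear_maps_comp[OF _ bilinear_opD(1)[OF mul_bilinear]]
  linear_maps_comp[OF _ bilinear_opD(2)[OF mul_bilinear]]

section \<open>Commutativity, unit and recursion on all tensors\<close>

lemma mul_comm:
  assumes "x \<in> carrier S" "y \<in> carrier S"
  shows "x \<star> y = y \<star> x"
proof (rule Sh_plus_bilinear_eq[OF mul_bilinear, of "\<lambda>x y. y \<star> x"])
  show "bilinear_op K S (\<lambda>x y. y \<star> x)"
    using mul_bilinear by (auto simp: bilinear_op_def)
qed (use assms in \<open>auto simp: mul_pure word_shuffle_comm\<close>)

lemma mul_unit_left [simp]:
  assumes "x \<in> carrier S"
  shows "p [] \<star> x = x"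
  by (rule Sh_plus_linear_eq[OF S.module_axioms, of "\<lambda>x. p [] \<star> x" "\<lambda>x. x"])
    (use assms in \<open>auto simp: in_lists_conv_set mul_pure intro!: linear_intros\<close>)

lemma mul_unit_right [simp]: "x \<in> carrier S \<Longrightarrow> x \<star> p [] = x"
  using mul_comm[of x "p []"] by simp

text \<open>Both sides are linear in \<open>x\<close> and in \<open>y\<close>, so the recursion
  passes from words to arbitrary tails.\<close>

lemma mul_t:
  assumes a: "a \<in> carrier A" and b: "b \<in> carrier A" and x: "x \<in> carrier S" and y: "y \<in> carrier S"
  shows "t a x \<star> t b y = t a (x \<star> t b y) \<oplus>\<^bsub>S\<^esub> t b (t a x \<star> y) \<oplus>\<^bsub>S\<^esub> t (a \<otimes>\<^bsub>A\<^esub> b) (tau (x \<star> y))"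
proof (rule Sh_plus_linear_eq[OF S.module_axioms _ _ _ x,
      of "\<lambda>x. t a x \<star> t b y" "\<lambda>x. t a (x \<star> t b y) \<oplus>\<^bsub>S\<^esub> t b (t a x \<star> y) \<oplus>\<^bsub>S\<^esub> t (a \<otimes>\<^bsub>A\<^esub> b) (tau (x \<star> y))"])
  fix u assume u: "u \<in> words"
  show "t a (p u) \<star> t b y = t a (p u \<star> t b y) \<oplus>\<^bsub>S\<^esub> t b (t a (p u) \<star> y) \<oplus>\<^bsub>S\<^esub> t (a \<otimes>\<^bsub>A\<^esub> b) (tau (p u \<star> y))"
    by (rule Sh_plus_linear_eq[OF S.module_axioms _ _ _ y, of "\<lambda>y. t a (p u) \<star> t b y"
          "\<lambda>y. t a (p u \<star> t b y) \<oplus>\<^bsub>S\<^esub> t b (t a (p u) \<star> y) \<oplus>\<^bsub>S\<^esub> t (a \<otimes>\<^bsub>A\<^esub> b) (tau (p u \<star> y))"])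
      (use a b u in \<open>auto simp: in_lists_conv_set mul_pure t_pure intro!: linear_intros\<close>)
qed (use a b y in \<open>auto intro!: linear_intros\<close>)

text \<open>If \<open>w\<close> is the empty word the product is \<open>t c y\<close>; otherwise
  every term of the recursion begins with a letter. Neither has a part in degree 0.\<close>

lemma deg0_mul_t:
  assumes c: "c \<in> carrier A" and w: "w \<in> carrier S" and y: "y \<in> carrier S"
  shows "deg0 (w \<star> t c y) = \<zero>\<^bsub>S\<^esub>"
proof (rule Sh_plus_linear_eq[OF S.module_axioms _ _ _ w, of "\<lambda>w. deg0 (w \<star> t c y)" "\<lambda>w. \<zero>\<^bsub>S\<^esub>"])
  fix u assume u: "u \<in> words"
  show "deg0 (p u \<star> t c y) = \<zero>\<^bsub>S\<^esub>"
  proof (cases u)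
    case Nil
    then show ?thesis using c y by simp
  next
    case (Cons a v)
    then have "p u = t a (p v)" "a \<in> carrier A" "v \<in> words" using u by (auto simp: t_pure)
    then show ?thesis using c y by (simp add: mul_t linear_mapsD(2)[OF deg0_linear])
  qed
qed (use c y in \<open>auto intro!: linear_intros\<close>)

text \<open>\<open>deg0 w\<close> is a scalar multiple of the unit: it kills nonempty words, and the
  empty word is neutral.\<close>

lemma deg0_mul_cons:
  assumes c: "c \<in> carrier A" and w: "w \<in> carrier S" and y: "y \<in> carrier S"
  shows "deg0 w \<star> t c y = t c (deg0 w \<star> y)"
proof (rule Sh_plus_linear_eq[OF S.module_axioms _ _ _ w, of "\<lambda>w. deg0 w \<star> t c y" "\<lambda>w. t c (deg0 w \<star> y)"])
  fix u assume u: "u \<in> words"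
  show "deg0 (p u) \<star> t c y = t c (deg0 (p u) \<star> y)"
    using c y linear_maps_zero[OF S.module_axioms S.module_axioms bilinear_opD(2)[OF mul_bilinear]]
    by (cases u) (auto simp: t_zero)
qed (use c y in \<open>auto intro!: linear_intros\<close>)

lemma tau_mul_left:
  assumes "w \<in> carrier S" "y \<in> carrier S"
  shows "tau w \<star> y = l \<odot>\<^bsub>S\<^esub> (deg0 w \<star> y) \<ominus>\<^bsub>S\<^esub> (t \<one>\<^bsub>A\<^esub> w \<star> y)"
  using assms by (simp add: tau_def mul_minus_left mul_smult_left)

text \<open>Write 1 for the unit of \<open>A\<close>. In (1 \<otimes> w) * (c \<otimes> y) two of
  the three terms begin with c, namely c \<otimes> ((1 \<otimes> w) * y) and c \<otimes> tau(w * y).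
  By the induction hypothesis for y they add up to l e(w) * (c \<otimes> y), which cancels the first
  part of tau(w) * (c \<otimes> y). What remains is -1 \<otimes> (w * (c \<otimes> y)), and this is
  tau of the product because the product has no part in degree 0.\<close>

lemma tau_mul:
  assumes w: "w \<in> carrier S" and z: "z \<in> carrier S"
  shows "tau w \<star> z = tau (w \<star> z)"
proof (rule Sh_plus_linear_eq[OF S.module_axioms _ _ _ z, of "\<lambda>z. tau w \<star> z" "\<lambda>z. tau (w \<star> z)"])
  fix u assume "u \<in> words"
  then show "tau w \<star> p u = tau (w \<star> p u)"
  proof (induction u rule: list.induct)
    case Nil
    then show ?case using w by simp
  next
    case (Cons c u)
    then have c: "c \<in> carrier A" and u: "u \<in> words" by auto
    define y where "y = p u"
    have y: "y \<in> carrier S" using u by (simp add: y_def)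
    have IH: "tau w \<star> y = tau (w \<star> y)" using Cons.IH[OF u] by (simp add: y_def)
    have "(t \<one>\<^bsub>A\<^esub> w \<star> y) \<oplus>\<^bsub>S\<^esub> tau (w \<star> y) = l \<odot>\<^bsub>S\<^esub> (deg0 w \<star> y)"
      unfolding IH[symmetric] tau_mul_left[OF w y] using w y
      by (simp add: S.M.add_minus_cancel)
    then have e: "t c (t \<one>\<^bsub>A\<^esub> w \<star> y) \<oplus>\<^bsub>S\<^esub> t c (tau (w \<star> y)) = l \<odot>\<^bsub>S\<^esub> (deg0 w \<star> t c y)"
      using w y c by (simp add: t_add[symmetric] t_smult deg0_mul_cons)
    have "t \<one>\<^bsub>A\<^esub> w \<star> t c y = t \<one>\<^bsub>A\<^esub> (w \<star> t c y) \<oplus>\<^bsub>S\<^esub> (t c (t \<one>\<^bsub>A\<^esub> w \<star> y) \<oplus>\<^bsub>S\<^esub> t c (tau (w \<star> y)))"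
      using w y c by (simp add: mul_t S.M.a_assoc)
    also have "\<dots> = t \<one>\<^bsub>A\<^esub> (w \<star> t c y) \<oplus>\<^bsub>S\<^esub> l \<odot>\<^bsub>S\<^esub> (deg0 w \<star> t c y)"
      by (simp only: e)
    finally have "tau w \<star> t c y = tau (w \<star> t c y)"
      using w y c
      by (simp add: tau_mul_left tau_def[of "w \<star> t c y"] deg0_mul_t S.M.minus_add_cancel)
        (simp add: a_minus_def)
    then show ?case using c u by (simp add: y_def t_pure)
  qed
qed (use w in \<open>auto intro!: linear_intros\<close>)

text \<open>The shape is chosen so that exchanging \<open>a\<close>, \<open>x\<close> with
  \<open>c\<close>, \<open>z\<close> permutes the seven terms, up to reordering inside the triple
  products; there is one term for each nonempty subset of the three leading letters. Direct
  expansion gives nine terms, three of which begin with \<open>c\<close> and fold back into one with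
  the tail \<open>t a x \<star> t b y \<star> z\<close>.\<close>

lemma mul_assoc_expand:
  assumes "a \<in> carrier A" "b \<in> carrier A" "c \<in> carrier A" "x \<in> carrier S" "y \<in> carrier S" "z \<in> carrier S"
  shows "(t a x \<star> t b y) \<star> t c z =
    t a (x \<star> t b y \<star> t c z) \<oplus>\<^bsub>S\<^esub> (t b (t a x \<star> y \<star> t c z) \<oplus>\<^bsub>S\<^esub> (t c (t a x \<star> t b y \<star> z) \<oplus>\<^bsub>S\<^esub>
    (t (a \<otimes>\<^bsub>A\<^esub> b) (tau (x \<star> y \<star> t c z)) \<oplus>\<^bsub>S\<^esub> (t (a \<otimes>\<^bsub>A\<^esub> c) (tau (x \<star> t b y \<star> z)) \<oplus>\<^bsub>S\<^esub>
    (t (b \<otimes>\<^bsub>A\<^esub> c) (tau (t a x \<star> y \<star> z)) \<oplus>\<^bsub>S\<^esub> t (a \<otimes>\<^bsub>A\<^esub> b \<otimes>\<^bsub>A\<^esub> c) (tau (tau (x \<star> y \<star> z))))))))"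
proof -
  have "t c (t a x \<star> t b y \<star> z) = t c (t a (x \<star> t b y) \<star> z) \<oplus>\<^bsub>S\<^esub> (t c (t b (t a x \<star> y) \<star> z) \<oplus>\<^bsub>S\<^esub>
      t c (t (a \<otimes>\<^bsub>A\<^esub> b) (tau (x \<star> y)) \<star> z))"
    using assms by (simp add: mul_t[of a b x y] mul_add_left t_add S.M.a_assoc)
  then show ?thesis using assms
    by (simp add: mul_t[of a b x y] mul_t[of _ c _ z] mul_add_left tau_mul S.M.a_ac)
qed

lemma mul_assoc:
  assumes "x \<in> carrier S" "y \<in> carrier S" "z \<in> carrier S"
  shows "(x \<star> y) \<star> z = x \<star> (y \<star> z)"
proof -
  \<comment> \<open>The seven hypotheses shorten each nonempty subset of the three factors, one for
    each term of \<open>mul_assoc_expand\<close>.\<close>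
  have step: "(t a x \<star> t b y) \<star> t c z = t a x \<star> (t b y \<star> t c z)"
    if "a \<in> carrier A" "b \<in> carrier A" "c \<in> carrier A" "x \<in> carrier S" "y \<in> carrier S" "z \<in> carrier S"
      and IH: "x \<star> t b y \<star> t c z = x \<star> (t b y \<star> t c z)" "t a x \<star> y \<star> t c z = t a x \<star> (y \<star> t c z)"
        "t a x \<star> t b y \<star> z = t a x \<star> (t b y \<star> z)" "x \<star> y \<star> t c z = x \<star> (y \<star> t c z)"
        "x \<star> t b y \<star> z = x \<star> (t b y \<star> z)" "t a x \<star> y \<star> z = t a x \<star> (y \<star> z)" "x \<star> y \<star> z = x \<star> (y \<star> z)"
    for a b c x y z
  proof -
    \<comment> \<open>Commutativity turns the right bracketing into a left bracketing with the
      factors in reverse order, so the same expansion applies to both sides.\<close>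
    have "t a x \<star> (t b y \<star> t c z) = (t c z \<star> t b y) \<star> t a x"
      using that(1-6) by (simp add: mul_comm)
    also have "\<dots> = (t a x \<star> t b y) \<star> t c z"
    proof -
      \<comment> \<open>Reversing a left-bracketed triple product needs associativity, which is
        available for these shorter triples.\<close>
      have "z \<star> t b y \<star> t a x = t a x \<star> t b y \<star> z" "t c z \<star> y \<star> t a x = t a x \<star> y \<star> t c z"
        "t c z \<star> t b y \<star> x = x \<star> t b y \<star> t c z" "z \<star> y \<star> t a x = t a x \<star> y \<star> z"
        "z \<star> t b y \<star> x = x \<star> t b y \<star> z" "t c z \<star> y \<star> x = x \<star> y \<star> t c z" "z \<star> y \<star> x = x \<star> y \<star> z"
        unfolding IH using that(1-6) by (simp_all add: mul_comm)
      moreover have "c \<otimes>\<^bsub>A\<^esub> b = b \<otimes>\<^bsub>A\<^esub> c" "c \<otimes>\<^bsub>A\<^esub> a = a \<otimes>\<^bsub>A\<^esub> c" "b \<otimes>\<^bsub>A\<^esub> a = a \<otimes>\<^bsub>A\<^esub> b"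
        "b \<otimes>\<^bsub>A\<^esub> c \<otimes>\<^bsub>A\<^esub> a = a \<otimes>\<^bsub>A\<^esub> b \<otimes>\<^bsub>A\<^esub> c"
        using that(1-3) by (simp_all add: m_ac)
      ultimately show ?thesis
        unfolding mul_assoc_expand[OF that(1-6)] mul_assoc_expand[OF that(3,2,1,6,5,4)]
        using that(1-6) by (simp add: S.M.a_ac)
    qed
    finally show ?thesis by simp
  qed
  have pure: "(p u \<star> p v) \<star> p w = p u \<star> (p v \<star> p w)"
    if "u \<in> words" "v \<in> words" "w \<in> words" for u v w
    using that
  \<comment> \<open>Total length is the measure because the hypotheses of \<open>step\<close>
    shorten the three words in all combinations.\<close>
  proof (induction "length u + length v + length w" arbitrary: u v w rule: less_induct)
    case less
    show ?case
    proof (cases "u = [] \<or> v = [] \<or> w = []")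
      case True
      then show ?thesis using less.prems by (auto simp: in_lists_conv_set)
    next
      case False
      then obtain a u' b v' c w' where e: "u = a # u'" "v = b # v'" "w = c # w'"
        by (meson list.exhaust)
      have m: "a \<in> carrier A" "b \<in> carrier A" "c \<in> carrier A" "u' \<in> words" "v' \<in> words" "w' \<in> words"
        using less.prems e by auto
      have "(t a (p u') \<star> t b (p v')) \<star> t c (p w') = t a (p u') \<star> (t b (p v') \<star> t c (p w'))"
        by (rule step) (use m e in \<open>auto simp: t_pure in_lists_conv_set intro!: less.hyps\<close>)
      then show ?thesis using m by (simp add: e t_pure)
    qed
  qed
  have "x \<star> p v \<star> p w = x \<star> (p v \<star> p w)" if "v \<in> words" "w \<in> words" for v w
    by (rule Sh_plus_linear_eq[OF S.module_axioms _ _ _ assms(1), of "\<lambda>x. x \<star> p v \<star> p w" "\<lambda>x. x \<star> (p v \<star> p w)"])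
      (use that pure in \<open>auto simp: in_lists_conv_set intro!: linear_intros\<close>)
  then have "x \<star> y \<star> p w = x \<star> (y \<star> p w)" if "w \<in> words" for w
    by (intro Sh_plus_linear_eq[OF S.module_axioms _ _ _ assms(2), of "\<lambda>y. x \<star> y \<star> p w" "\<lambda>y. x \<star> (y \<star> p w)"])
      (use that assms in \<open>auto simp: in_lists_conv_set intro!: linear_intros\<close>)
  then show ?thesis
    by (intro Sh_plus_linear_eq[OF S.module_axioms _ _ _ assms(3), of "\<lambda>z. x \<star> y \<star> z" "\<lambda>z. x \<star> (y \<star> z)"])
      (use assms in \<open>auto intro!: linear_intros\<close>)
qed

end

text \<open>The descriptions ask for \<open>undefined\<close> outside the carrier, where the chosen
  products \<open>mul\<close> and \<open>diamond\<close> take unknown values.\<close>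

definition ext_op :: "'s set \<Rightarrow> ('s \<Rightarrow> 's \<Rightarrow> 's) \<Rightarrow> 's \<Rightarrow> 's \<Rightarrow> 's"
  where "ext_op B f x y = (if x \<in> B \<and> y \<in> B then f x y else undefined)"

lemma ext_op_bilinear:
  assumes "module K M" "bilinear_op K M f"
  shows "bilinear_op K M (ext_op (carrier M) f)"
proof -
  interpret M: module K M by fact
  note lin = bilinear_opD(3)[OF assms(2)] linear_mapsD(2,3)[OF bilinear_opD(1)[OF assms(2)]]
    linear_mapsD(2,3)[OF bilinear_opD(2)[OF assms(2)]]
  show ?thesis
    unfolding bilinear_op_def by (intro ballI conjI linear_mapsI) (simp_all add: ext_op_def lin)
qed

section \<open>The described shuffle product is the constructed one\<close>

context shuffle_setup
begin

text \<open>Apply \<open>tau_mul\<close> to \<open>x\<close> written as the unit times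
  \<open>x\<close>: the value of \<open>tau\<close> at the unit comes out as a factor.\<close>

lemma tau_eq:
  assumes "x \<in> carrier S"
  shows "tau x = l \<odot>\<^bsub>S\<^esub> x \<ominus>\<^bsub>S\<^esub> (x \<star> p [\<one>\<^bsub>A\<^esub>])"
proof -
  have "tau x = tau (p []) \<star> x" using assms tau_mul[of "p []" x] by simp
  also have "\<dots> = l \<odot>\<^bsub>S\<^esub> x \<ominus>\<^bsub>S\<^esub> (p [\<one>\<^bsub>A\<^esub>] \<star> x)"
    using assms by (simp add: tau_mul_left t_pure)
  also have "p [\<one>\<^bsub>A\<^esub>] \<star> x = x \<star> p [\<one>\<^bsub>A\<^esub>]" using assms by (intro mul_comm) auto
  finally show ?thesis .
qed

lemma tau_mul_eq:
  assumes "x \<in> carrier S" "y \<in> carrier S"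
  shows "tau (x \<star> y) = l \<odot>\<^bsub>S\<^esub> (x \<star> y) \<ominus>\<^bsub>S\<^esub> (x \<star> p [\<one>\<^bsub>A\<^esub>] \<star> y)"
  using assms unfolding tau_mul[OF assms, symmetric] by (simp add: tau_eq mul_minus_left mul_smult_left)

lemma mul_is_td_shuffle: "is_td_shuffle K A l mul"
  unfolding is_td_shuffle_def Let_def
proof (intro conjI ballI)
  show "bilinear_op K S mul" by (rule mul_bilinear)
next
  fix c x assume c: "c \<in> carrier K" and x: "x \<in> carrier S"
  then show "c \<odot>\<^bsub>S\<^esub> p [] \<star> x = c \<odot>\<^bsub>S\<^esub> x" "x \<star> (c \<odot>\<^bsub>S\<^esub> p []) = c \<odot>\<^bsub>S\<^esub> x"
    by (simp_all add: mul_smult_left mul_smult_right)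
next
  fix a b u v assume h: "a \<in> carrier A" "b \<in> carrier A" "u \<in> words" "v \<in> words"
  have "p (a # u) \<star> p (b # v) = t a (p u \<star> p (b # v)) \<oplus>\<^bsub>S\<^esub> t b (p (a # u) \<star> p v)
      \<oplus>\<^bsub>S\<^esub> t (a \<otimes>\<^bsub>A\<^esub> b) (tau (p u \<star> p v))"
    using mul_t[OF h(1,2) p_closed[OF h(3)] p_closed[OF h(4)]] h by (simp add: t_pure)
  also have "t (a \<otimes>\<^bsub>A\<^esub> b) (tau (p u \<star> p v)) = l \<odot>\<^bsub>S\<^esub> t (a \<otimes>\<^bsub>A\<^esub> b) (p u \<star> p v)
      \<ominus>\<^bsub>S\<^esub> t (a \<otimes>\<^bsub>A\<^esub> b) (p u \<star> p [\<one>\<^bsub>A\<^esub>] \<star> p v)"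
    using h by (simp add: tau_mul_eq t_minus t_smult)
  finally show "p (a # u) \<star> p (b # v) = t a (p u \<star> p (b # v)) \<oplus>\<^bsub>S\<^esub> t b (p (a # u) \<star> p v)
      \<oplus>\<^bsub>S\<^esub> l \<odot>\<^bsub>S\<^esub> t (a \<otimes>\<^bsub>A\<^esub> b) (p u \<star> p v)
      \<ominus>\<^bsub>S\<^esub> t (a \<otimes>\<^bsub>A\<^esub> b) (p u \<star> p [\<one>\<^bsub>A\<^esub>] \<star> p v)"
    using h by (simp add: a_minus_def S.M.a_assoc)
qed

lemma is_td_shuffle_rules:
  assumes "is_td_shuffle K A l sh"
  shows "bilinear_op K S sh"
    and "\<And>x. x \<in> carrier S \<Longrightarrow> sh (p []) x = x"
    and "\<And>x. x \<in> carrier S \<Longrightarrow> sh x (p []) = x"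
    and "\<And>a b u v. a \<in> carrier A \<Longrightarrow> b \<in> carrier A \<Longrightarrow> u \<in> words \<Longrightarrow> v \<in> words \<Longrightarrow>
      sh (p (a # u)) (p (b # v)) =
           t a (sh (p u) (p (b # v)))
           \<oplus>\<^bsub>S\<^esub> t b (sh (p (a # u)) (p v))
           \<oplus>\<^bsub>S\<^esub> l \<odot>\<^bsub>S\<^esub> t (a \<otimes>\<^bsub>A\<^esub> b) (sh (p u) (p v))
           \<ominus>\<^bsub>S\<^esub> t (a \<otimes>\<^bsub>A\<^esub> b) (sh (sh (p u) (p [\<one>\<^bsub>A\<^esub>])) (p v))"
proof -
  note d = assms[unfolded is_td_shuffle_def Let_def]
  show "bilinear_op K S sh" using d by blast
  have e: "\<one>\<^bsub>K\<^esub> \<odot>\<^bsub>S\<^esub> p [] = p []" by simp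
  show "\<And>x. x \<in> carrier S \<Longrightarrow> sh (p []) x = x" "\<And>x. x \<in> carrier S \<Longrightarrow> sh x (p []) = x"
    using d e R.one_closed S.smult_one by metis+
  show "\<And>a b u v. a \<in> carrier A \<Longrightarrow> b \<in> carrier A \<Longrightarrow> u \<in> words \<Longrightarrow> v \<in> words \<Longrightarrow>
      sh (p (a # u)) (p (b # v)) =
           t a (sh (p u) (p (b # v)))
           \<oplus>\<^bsub>S\<^esub> t b (sh (p (a # u)) (p v))
           \<oplus>\<^bsub>S\<^esub> l \<odot>\<^bsub>S\<^esub> t (a \<otimes>\<^bsub>A\<^esub> b) (sh (p u) (p v))
           \<ominus>\<^bsub>S\<^esub> t (a \<otimes>\<^bsub>A\<^esub> b) (sh (sh (p u) (p [\<one>\<^bsub>A\<^esub>])) (p v))"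
    using d by blast
qed

text \<open>When the second word consists of the unit of \<open>A\<close> alone, the first and the
  last term of the recursion coincide and cancel. Any solution therefore has this product in closed
  form, before anything is known about its other values.\<close>

lemma td_shuffle_one:
  assumes sh: "is_td_shuffle K A l sh" and a: "a \<in> carrier A" and u: "u \<in> words"
  shows "sh (p (a # u)) (p [\<one>\<^bsub>A\<^esub>]) = p (\<one>\<^bsub>A\<^esub> # a # u) \<oplus>\<^bsub>S\<^esub> l \<odot>\<^bsub>S\<^esub> p (a # u)"
proof -
  note r = is_td_shuffle_rules[OF sh]
  define z where "z = t a (sh (p u) (p [\<one>\<^bsub>A\<^esub>]))"
  have z: "z \<in> carrier S" using a u by (auto simp: z_def intro!: bilinear_opD(3)[OF r(1)])
  have c: "sh (p u) (p [\<one>\<^bsub>A\<^esub>]) \<in> carrier S" using u by (intro bilinear_opD(3)[OF r(1)]) auto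
  have "sh (p (a # u)) (p [\<one>\<^bsub>A\<^esub>]) = z \<oplus>\<^bsub>S\<^esub> p (\<one>\<^bsub>A\<^esub> # a # u) \<oplus>\<^bsub>S\<^esub> l \<odot>\<^bsub>S\<^esub> p (a # u) \<ominus>\<^bsub>S\<^esub> z"
    using r(4)[OF a one_closed u, of "[]"] a u c by (simp add: r(3) t_pure z_def)
  also have "\<dots> = z \<oplus>\<^bsub>S\<^esub> ((p (\<one>\<^bsub>A\<^esub> # a # u) \<oplus>\<^bsub>S\<^esub> l \<odot>\<^bsub>S\<^esub> p (a # u)) \<ominus>\<^bsub>S\<^esub> z)"
    using z a u by (simp add: a_minus_def S.M.a_assoc)
  also have "\<dots> = p (\<one>\<^bsub>A\<^esub> # a # u) \<oplus>\<^bsub>S\<^esub> l \<odot>\<^bsub>S\<^esub> p (a # u)"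
    using z a u by (intro S.M.add_minus_cancel) simp_all
  finally show ?thesis .
qed

text \<open>The difficulty is the nested product, whose inner value is not a word. By
  \<open>td_shuffle_one\<close> it is a combination of \<open>u'\<close> and of \<open>u'\<close>
  with the unit of \<open>A\<close> in front. Neither is longer than \<open>u\<close>, so together
  with \<open>v'\<close> they fall under the induction on total length.\<close>

lemma td_shuffle_unique_pure:
  assumes sh: "is_td_shuffle K A l sh" and "u \<in> words" "v \<in> words"
  shows "sh (p u) (p v) = p u \<star> p v"
  using assms(2,3)
proof (induction "length u + length v" arbitrary: u v rule: less_induct)
  case less
  note r = is_td_shuffle_rules[OF sh]
  note r' = is_td_shuffle_rules[OF mul_is_td_shuffle]
  show ?case
  proof (cases "u = [] \<or> v = []")
    case True
    then show ?thesis using less.prems r(2,3) by (auto simp: in_lists_conv_set)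
  next
    case False
    then obtain a u' b v' where e: "u = a # u'" "v = b # v'" by (meson list.exhaust)
    have m: "a \<in> carrier A" "b \<in> carrier A" "u' \<in> words" "v' \<in> words"
      using less.prems e by auto
    have IH: "sh (p w) (p z) = p w \<star> p z"
      if "w \<in> words" "z \<in> words" "length w + length z < length u + length v" for w z
      using less.hyps that by blast
    have one: "sh (sh (p u') (p [\<one>\<^bsub>A\<^esub>])) (p v') = (p u' \<star> p [\<one>\<^bsub>A\<^esub>]) \<star> p v'"
    proof (cases u')
      \<comment> \<open>Here the unit rule gives the inner product, a word of length one;
        \<open>td_shuffle_one\<close> speaks of words with a leading letter.\<close>
      case Nil
      then show ?thesis using m r(2) IH[of "[\<one>\<^bsub>A\<^esub>]" v'] by (simp add: e)
    next
      case (Cons c w)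
      then have c: "c \<in> carrier A" "w \<in> words" using m by auto
      note add = linear_mapsD(2)[OF bilinear_opD(2)[OF r(1)]]
        and smult = linear_mapsD(3)[OF bilinear_opD(2)[OF r(1)]]
      show ?thesis unfolding Cons td_shuffle_one[OF sh c] td_shuffle_one[OF mul_is_td_shuffle c]
        using c m IH[of "\<one>\<^bsub>A\<^esub> # c # w" v'] IH[of "c # w" v']
        by (simp add: add smult mul_add_left mul_smult_left e Cons)
    qed
    show ?thesis unfolding e r(4)[OF m] r'(4)[OF m] one
      using m IH[of u' "b # v'"] IH[of "a # u'" v'] IH[of u' v'] by (simp add: e)
  qed
qed

text \<open>The rules that define a solution evaluate it on carrier elements only, so
  \<open>mul\<close> still satisfies them after its outside values are reset.\<close>

lemma td_shuffle_eq_ext_op: "td_shuffle K A l = ext_op (carrier S) mul"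
  unfolding td_shuffle_def
proof (rule the_equality)
  have "is_td_shuffle K A l (ext_op (carrier S) mul)"
    unfolding is_td_shuffle_def Let_def
  proof (intro conjI)
    show "bilinear_op K S (ext_op (carrier S) mul)"
      by (rule ext_op_bilinear[OF S.module_axioms mul_bilinear])
    show "\<forall>c\<in>carrier K. \<forall>x\<in>carrier S. ext_op (carrier S) mul (c \<odot>\<^bsub>S\<^esub> p []) x = c \<odot>\<^bsub>S\<^esub> x \<and>
        ext_op (carrier S) mul x (c \<odot>\<^bsub>S\<^esub> p []) = c \<odot>\<^bsub>S\<^esub> x"
      by (simp add: ext_op_def mul_smult_left mul_smult_right)
    show "\<forall>a\<in>carrier A. \<forall>b\<in>carrier A. \<forall>u\<in>words. \<forall>v\<in>words.
         ext_op (carrier S) mul (p (a # u)) (p (b # v)) =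
           t a (ext_op (carrier S) mul (p u) (p (b # v)))
           \<oplus>\<^bsub>S\<^esub> t b (ext_op (carrier S) mul (p (a # u)) (p v))
           \<oplus>\<^bsub>S\<^esub> l \<odot>\<^bsub>S\<^esub> t (a \<otimes>\<^bsub>A\<^esub> b) (ext_op (carrier S) mul (p u) (p v))
           \<ominus>\<^bsub>S\<^esub> t (a \<otimes>\<^bsub>A\<^esub> b) (ext_op (carrier S) mul (ext_op (carrier S) mul (p u) (p [\<one>\<^bsub>A\<^esub>])) (p v))"
      using is_td_shuffle_rules(4)[OF mul_is_td_shuffle] by (simp add: ext_op_def)
  qed
  then show "extensional_op (carrier S) (ext_op (carrier S) mul) \<and> is_td_shuffle K A l (ext_op (carrier S) mul)"
    by (simp add: extensional_op_def ext_op_def)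
  fix sh assume sh: "extensional_op (carrier S) sh \<and> is_td_shuffle K A l sh"
  then have "sh x y = mul x y" if "x \<in> carrier S" "y \<in> carrier S" for x y
    using that td_shuffle_unique_pure is_td_shuffle_rules(1) Sh_plus_bilinear_eq[OF _ mul_bilinear] by blast
  then show "sh = ext_op (carrier S) mul"
    using sh by (auto simp: fun_eq_iff ext_op_def extensional_op_def)
qed

lemma td_shuffle_eq: "x \<in> carrier S \<Longrightarrow> y \<in> carrier S \<Longrightarrow> td_shuffle K A l x y = x \<star> y"
  by (simp add: td_shuffle_eq_ext_op ext_op_def)

section \<open>The algebra \<open>Sh(A)\<close>\<close>

abbreviation "SM \<equiv> Sh_module K A"

lemma SM_simps [simp]:
  "\<zero>\<^bsub>SM\<^esub> = \<zero>\<^bsub>S\<^esub>" "x \<oplus>\<^bsub>SM\<^esub> y = x \<oplus>\<^bsub>S\<^esub> y" "c \<odot>\<^bsub>SM\<^esub> x = c \<odot>\<^bsub>S\<^esub> x"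
  by (simp_all add: Sh_module_def)

text \<open>As the kernel of the linear map \<open>deg0\<close>, the carrier is a submodule of
  \<open>S\<close>.\<close>

lemma SM_carrier: "carrier SM = {x \<in> carrier S. deg0 x = \<zero>\<^bsub>S\<^esub>}"
  by (simp add: Sh_module_def deg0_eq_zero_iff)

lemma SM_S [intro]: "x \<in> carrier SM \<Longrightarrow> x \<in> carrier S"
  by (simp add: SM_carrier)

lemma t_SM [simp, intro]: "a \<in> carrier A \<Longrightarrow> x \<in> carrier S \<Longrightarrow> t a x \<in> carrier SM"
  by (simp add: SM_carrier)

sublocale SM: module K SM
proof -
  have "SM = S\<lparr>carrier := {x \<in> carrier S. deg0 x = \<zero>\<^bsub>S\<^esub>}\<rparr>"
    by (simp add: Sh_module_def deg0_eq_zero_iff)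
  then show "module K SM"
    using submodule.submodule_is_module[OF
        linear_kernel_submodule[OF S.module_axioms S.module_axioms deg0_linear] S.module_axioms]
    by simp
qed

text \<open>\<open>a_inv\<close> searches the carrier for an inverse, so the two subtractions do not
  agree by unfolding; on \<open>SM\<close> both amount to adding -1 times \<open>y\<close>.\<close>

lemma SM_a_minus: "x \<in> carrier SM \<Longrightarrow> y \<in> carrier SM \<Longrightarrow> x \<ominus>\<^bsub>SM\<^esub> y = x \<ominus>\<^bsub>S\<^esub> y"
  by (simp add: a_minus_def SM.neg_eq_smult S.neg_eq_smult SM_S)

lemma linear_maps_SM: "f \<in> linear_maps K S N \<Longrightarrow> f \<in> linear_maps K SM N"
  using SM_S by (auto simp: linear_maps_def)

lemma linear_maps_to_SM:
  "f \<in> linear_maps K N S \<Longrightarrow> (\<And>x. x \<in> carrier N \<Longrightarrow> deg0 (f x) = \<zero>\<^bsub>S\<^esub>) \<Longrightarrow> f \<in> linear_maps K N SM"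
  by (auto simp: linear_maps_def SM_carrier)

text \<open>An induction over \<open>S\<close> does not stay within \<open>SM\<close>, so it is run
  for the statement \<open>Q (r x)\<close>, where \<open>r\<close> removes the part in degree 0. The
  map \<open>r\<close> is linear, lands in \<open>SM\<close> and fixes the elements of
  \<open>SM\<close>.\<close>

lemma Sh_induct [consumes 1, case_names zero pure add smult]:
  assumes x: "x \<in> carrier SM"
    and zero: "Q \<zero>\<^bsub>S\<^esub>"
    and pure: "\<And>a w. a \<in> carrier A \<Longrightarrow> w \<in> words \<Longrightarrow> Q (t a (p w))"
    and add: "\<And>x y. x \<in> carrier SM \<Longrightarrow> y \<in> carrier SM \<Longrightarrow> Q x \<Longrightarrow> Q y \<Longrightarrow> Q (x \<oplus>\<^bsub>S\<^esub> y)"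
    and smult: "\<And>c x. c \<in> carrier K \<Longrightarrow> x \<in> carrier SM \<Longrightarrow> Q x \<Longrightarrow> Q (c \<odot>\<^bsub>S\<^esub> x)"
  shows "Q x"
proof -
  define r where "r x = x \<ominus>\<^bsub>S\<^esub> deg0 x" for x
  have r: "r \<in> linear_maps K S S" unfolding r_def[abs_def] by (intro linear_intros deg0_linear)
  have r0: "r x \<in> carrier SM" if "x \<in> carrier S" for x
  proof -
    have "deg0 (deg0 x) = deg0 x" by (simp add: deg0_def fun_eq_iff)
    then show ?thesis using that
      by (simp add: SM_carrier r_def linear_maps_minus[OF S.module_axioms S.module_axioms deg0_linear]
          S.M.minus_eq_zero_iff)
  qed
  have "Q (r x)" if "x \<in> carrier S" for x
    using that
  proof (induction rule: Sh_plus_induct)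
    case zero
    show ?case using assms(2) by (simp add: linear_maps_zero[OF S.module_axioms S.module_axioms r])
  next
    case (pure w)
    show ?case
    proof (cases w)
      case Nil
      then show ?thesis using assms(2) S.M.minus_eq_zero_iff[of "p []" "p []"] by (simp add: r_def)
    next
      case (Cons a v)
      then have "r (p w) = t a (p v)" "a \<in> carrier A" "v \<in> words"
        using pure linear_mapsD(1)[OF r p_closed[OF pure]]
        by (simp_all add: r_def t_pure S.M.minus_eq)
      then show ?thesis using assms(3) by simp
    qed
  next
    case (add x y)
    then show ?case using assms(4) r0 by (simp add: linear_mapsD(2)[OF r])
  next
    case (smult c x)
    then show ?case using assms(5) r0 by (simp add: linear_mapsD(3)[OF r])
  qed
  moreover have "r x = x" using x by (simp add: r_def SM_carrier S.M.minus_eq)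
  ultimately show ?thesis using x by (metis SM_S)
qed

lemma Sh_linear_eq:
  assumes "module K N" "f \<in> linear_maps K SM N" "g \<in> linear_maps K SM N"
    and "\<And>a w. a \<in> carrier A \<Longrightarrow> w \<in> words \<Longrightarrow> f (t a (p w)) = g (t a (p w))"
    and "x \<in> carrier SM"
  shows "f x = g x"
proof -
  have "f \<zero>\<^bsub>S\<^esub> = g \<zero>\<^bsub>S\<^esub>"
    using linear_maps_zero[OF SM.module_axioms assms(1,2)] linear_maps_zero[OF SM.module_axioms assms(1,3)]
    by simp
  with assms(5) show ?thesis
    by (induction rule: Sh_induct)
      (use assms(4) linear_mapsD[OF assms(2)] linear_mapsD[OF assms(3)] in simp_all)
qed

text \<open>Extended by zero to the empty word, so that the lifting property of the whole of
  \<open>S\<close> applies; its restriction to \<open>SM\<close> is what gets compared with the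
  product of the statement.\<close>

fun word_diamond :: "'a list \<Rightarrow> 'a list \<Rightarrow> ('k, 'a) tensors"
  where
    "word_diamond (a # u) (b # v) = t (a \<otimes>\<^bsub>A\<^esub> b) (p u \<star> p v)"
  | "word_diamond u v = \<zero>\<^bsub>S\<^esub>"

lemma word_diamond_Nil [simp]: "word_diamond u [] = \<zero>\<^bsub>S\<^esub>"
  by (cases u) auto

lemma word_diamond_comm: "u \<in> words \<Longrightarrow> v \<in> words \<Longrightarrow> word_diamond u v = word_diamond v u"
  by (cases u; cases v) (simp_all add: m_comm mul_comm)

lemma word_diamond_multilinear:
  assumes "u \<in> words"
  shows "multilinear K A S (word_diamond u)"
proof (cases u)
  case Nil
  moreover have "word_diamond [] = (\<lambda>w. \<zero>\<^bsub>S\<^esub>)" by auto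
  ultimately show ?thesis using multilinear_null[OF S.module_axioms] by simp
next
  case (Cons a u')
  then have a: "a \<in> carrier A" and u': "u' \<in> words" using assms by auto
  show ?thesis unfolding Cons
  proof (rule multilinear_ConsI)
    fix b assume b: "b \<in> carrier A"
    have "(\<lambda>x. t (a \<otimes>\<^bsub>A\<^esub> b) (p u' \<star> x)) \<in> linear_maps K S S"
      using a b u' by (intro linear_intros) auto
    then show "multilinear K A S (\<lambda>w. word_diamond (a # u') (b # w))"
      using multilinear_comp[OF p_multilinear] by simp
  next
    fix w assume "w \<in> words"
    then show "(\<lambda>x. word_diamond (a # u') (x # w)) \<in> linear_maps K A S"
      using a u' linear_maps_comp[OF A_mult_linear t_linear_left] by simp
  qed simp
qed

definition diamond :: "('k, 'a) tensors \<Rightarrow> ('k, 'a) tensors \<Rightarrow> ('k, 'a) tensors"  (infixl "\<diamondop>" 70)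
  where "diamond = (SOME h. bilinear_op K S h \<and> (\<forall>u\<in>words. \<forall>v\<in>words. h (p u) (p v) = word_diamond u v))"

lemma diamond_bilinear: "bilinear_op K S diamond"
  and diamond_pure: "u \<in> words \<Longrightarrow> v \<in> words \<Longrightarrow> p u \<diamondop> p v = word_diamond u v"
proof -
  have "multilinear K A S (\<lambda>u. word_diamond u v)" if v: "v \<in> words" for v
    using word_diamond_multilinear[OF v] v word_diamond_comm[OF _ v] unfolding multilinear_def
    by (auto simp: linear_maps_def Pi_def)
  from someI_ex[OF Sh_plus_bilinear_lift[OF this word_diamond_multilinear]]
  have "bilinear_op K S diamond \<and> (\<forall>u\<in>words. \<forall>v\<in>words. diamond (p u) (p v) = word_diamond u v)"
    unfolding diamond_def .
  then show "bilinear_op K S diamond" "u \<in> words \<Longrightarrow> v \<in> words \<Longrightarrow> p u \<diamondop> p v = word_diamond u v" by auto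
qed

lemma diamond_closed [simp, intro]: "x \<in> carrier S \<Longrightarrow> y \<in> carrier S \<Longrightarrow> x \<diamondop> y \<in> carrier S"
  using bilinear_opD(3)[OF diamond_bilinear] .

lemmas diamond_add_left = linear_mapsD(2)[OF bilinear_opD(2)[OF diamond_bilinear]]
lemmas diamond_smult_left = linear_mapsD(3)[OF bilinear_opD(2)[OF diamond_bilinear]]

lemmas diamond_linear_intros = linear_intros
  linear_maps_comp[OF _ bilinear_opD(1)[OF diamond_bilinear]]
  linear_maps_comp[OF _ bilinear_opD(2)[OF diamond_bilinear]]

lemma diamond_t:
  assumes a: "a \<in> carrier A" and b: "b \<in> carrier A" and x: "x \<in> carrier S" and y: "y \<in> carrier S"
  shows "t a x \<diamondop> t b y = t (a \<otimes>\<^bsub>A\<^esub> b) (x \<star> y)"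
proof (rule Sh_plus_linear_eq[OF S.module_axioms _ _ _ x,
      of "\<lambda>x. t a x \<diamondop> t b y" "\<lambda>x. t (a \<otimes>\<^bsub>A\<^esub> b) (x \<star> y)"])
  fix u assume u: "u \<in> words"
  show "t a (p u) \<diamondop> t b y = t (a \<otimes>\<^bsub>A\<^esub> b) (p u \<star> y)"
    by (rule Sh_plus_linear_eq[OF S.module_axioms _ _ _ y, of "\<lambda>y. t a (p u) \<diamondop> t b y"
          "\<lambda>y. t (a \<otimes>\<^bsub>A\<^esub> b) (p u \<star> y)"])
      (use a b u in \<open>auto simp: in_lists_conv_set diamond_pure t_pure intro!: diamond_linear_intros\<close>)
qed (use a b y in \<open>auto intro!: diamond_linear_intros\<close>)

lemma deg0_diamond:
  assumes "x \<in> carrier S" "y \<in> carrier S"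
  shows "deg0 (x \<diamondop> y) = \<zero>\<^bsub>S\<^esub>"
proof (rule Sh_plus_linear_eq[OF S.module_axioms _ _ _ assms(1), of "\<lambda>x. deg0 (x \<diamondop> y)" "\<lambda>x. \<zero>\<^bsub>S\<^esub>"])
  fix u assume u: "u \<in> words"
  have word_diamond: "deg0 (word_diamond u v) = \<zero>\<^bsub>S\<^esub>" if "v \<in> words" for v
    using u that linear_maps_zero[OF S.module_axioms S.module_axioms deg0_linear]
    by (cases u; cases v) auto
  show "deg0 (p u \<diamondop> y) = \<zero>\<^bsub>S\<^esub>"
    by (rule Sh_plus_linear_eq[OF S.module_axioms _ _ _ assms(2), of "\<lambda>y. deg0 (p u \<diamondop> y)" "\<lambda>y. \<zero>\<^bsub>S\<^esub>"])
      (use u word_diamond in \<open>auto simp: in_lists_conv_set diamond_pure intro!: diamond_linear_intros\<close>)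
qed (use assms in \<open>auto intro!: diamond_linear_intros\<close>)

lemma diamond_SM [simp, intro]: "x \<in> carrier SM \<Longrightarrow> y \<in> carrier SM \<Longrightarrow> x \<diamondop> y \<in> carrier SM"
  by (simp add: SM_carrier deg0_diamond)

lemma diamond_SM_bilinear: "bilinear_op K SM diamond"
  unfolding bilinear_op_def
proof (intro ballI conjI)
  fix x assume x: "x \<in> carrier SM"
  show "diamond x \<in> linear_maps K SM SM"
    using x by (intro linear_maps_to_SM linear_maps_SM bilinear_opD(1)[OF diamond_bilinear] deg0_diamond SM_S)
  show "(\<lambda>y. y \<diamondop> x) \<in> linear_maps K SM SM"
    using x by (intro linear_maps_to_SM linear_maps_SM bilinear_opD(2)[OF diamond_bilinear] deg0_diamond SM_S)
qed

text \<open>The target \<open>N\<close> is arbitrary so that the same reduction serves for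
  identities in \<open>SM\<close>, in \<open>S\<close> and in the algebra of the universal
  property.\<close>

lemma Sh_bilinear_eq:
  assumes N: "module K N"
    and f: "\<And>x. x \<in> carrier SM \<Longrightarrow> f x \<in> linear_maps K SM N"
      "\<And>y. y \<in> carrier SM \<Longrightarrow> (\<lambda>x. f x y) \<in> linear_maps K SM N"
    and g: "\<And>x. x \<in> carrier SM \<Longrightarrow> g x \<in> linear_maps K SM N"
      "\<And>y. y \<in> carrier SM \<Longrightarrow> (\<lambda>x. g x y) \<in> linear_maps K SM N"
    and eq: "\<And>a b x y. a \<in> carrier A \<Longrightarrow> b \<in> carrier A \<Longrightarrow> x \<in> carrier S \<Longrightarrow> y \<in> carrier S \<Longrightarrow>
      f (t a x) (t b y) = g (t a x) (t b y)"
    and x: "x \<in> carrier SM" and y: "y \<in> carrier SM"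
  shows "f x y = g x y"
proof (rule Sh_linear_eq[OF N f(1)[OF x] g(1)[OF x] _ y])
  fix b v assume b: "b \<in> carrier A" "v \<in> words"
  then have s: "t b (p v) \<in> carrier SM" by auto
  show "f x (t b (p v)) = g x (t b (p v))"
    by (rule Sh_linear_eq[OF N f(2)[OF s] g(2)[OF s] _ x]) (use b eq in \<open>auto simp: in_lists_conv_set\<close>)
qed

text \<open>The elements a \<otimes> x generate \<open>SM\<close>, so bilinearity and the prescribed
  values determine the product on the carrier; outside it extensionality decides.\<close>

lemma td_diamond_eq_ext_op: "td_diamond K A l = ext_op (carrier SM) diamond"
  unfolding td_diamond_def
proof (rule the_equality)
  show "extensional_op (carrier SM) (ext_op (carrier SM) diamond) \<and>
      bilinear_op K SM (ext_op (carrier SM) diamond) \<and>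
      (\<forall>a\<in>carrier A. \<forall>b\<in>carrier A. \<forall>x\<in>carrier S. \<forall>y\<in>carrier S.
        ext_op (carrier SM) diamond (t a x) (t b y) = t (a \<otimes>\<^bsub>A\<^esub> b) (td_shuffle K A l x y))"
    using ext_op_bilinear[OF SM.module_axioms diamond_SM_bilinear]
    by (simp add: td_shuffle_eq diamond_t extensional_op_def ext_op_def)
  fix d assume d: "extensional_op (carrier SM) d \<and> bilinear_op K SM d \<and>
      (\<forall>a\<in>carrier A. \<forall>b\<in>carrier A. \<forall>x\<in>carrier S. \<forall>y\<in>carrier S.
        d (t a x) (t b y) = t (a \<otimes>\<^bsub>A\<^esub> b) (td_shuffle K A l x y))"
  have "d x y = diamond x y" if "x \<in> carrier SM" "y \<in> carrier SM" for x y
    by (rule Sh_bilinear_eq[OF SM.module_axioms _ _ _ _ _ that])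
      (use d bilinear_opD[OF diamond_SM_bilinear] bilinear_opD[of K SM d] in \<open>simp_all add: diamond_t td_shuffle_eq\<close>)
  then show "d = ext_op (carrier SM) diamond"
    using d by (auto simp: fun_eq_iff ext_op_def extensional_op_def)
qed

lemma td_diamond_eq: "x \<in> carrier SM \<Longrightarrow> y \<in> carrier SM \<Longrightarrow> td_diamond K A l x y = x \<diamondop> y"
  by (simp add: td_diamond_eq_ext_op ext_op_def)

section \<open>The algebra axioms and the TD identity\<close>

lemma Sh_simps [simp]:
  "carrier (Sh K A l) = carrier SM" "\<zero>\<^bsub>Sh K A l\<^esub> = \<zero>\<^bsub>S\<^esub>" "x \<oplus>\<^bsub>Sh K A l\<^esub> y = x \<oplus>\<^bsub>S\<^esub> y"
  "c \<odot>\<^bsub>Sh K A l\<^esub> x = c \<odot>\<^bsub>S\<^esub> x" "x \<otimes>\<^bsub>Sh K A l\<^esub> y = td_diamond K A l x y"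
  "\<one>\<^bsub>Sh K A l\<^esub> = p [\<one>\<^bsub>A\<^esub>]"
  by (simp_all add: Sh_def Sh_module_def)

lemma Sh_a_minus:
  assumes "x \<in> carrier SM" "y \<in> carrier SM"
  shows "x \<ominus>\<^bsub>Sh K A l\<^esub> y = x \<ominus>\<^bsub>S\<^esub> y"
proof -
  \<comment> \<open>The additive inverse depends on carrier, addition and zero, which the update of
    product and unit leaves alone.\<close>
  have "a_inv (Sh K A l) = a_inv SM" by (simp add: a_inv_def Sh_def)
  then have "x \<ominus>\<^bsub>Sh K A l\<^esub> y = x \<ominus>\<^bsub>SM\<^esub> y" by (simp add: a_minus_def)
  then show ?thesis using assms by (simp add: SM_a_minus)
qed

lemma linear_maps_Sh:
  "linear_maps K (Sh K A l) N = linear_maps K SM N" "linear_maps K N (Sh K A l) = linear_maps K N SM"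
  by (simp_all add: linear_maps_def)

lemma pure_singleton: "a \<in> carrier A \<Longrightarrow> p [a] = t a (p [])"
  by (simp add: t_pure)

lemma one_SM [simp]: "p [\<one>\<^bsub>A\<^esub>] \<in> carrier SM"
  by (simp add: pure_singleton)

lemmas SM_intros = linear_maps_comp[OF _ bilinear_opD(1)[OF diamond_SM_bilinear]]
  linear_maps_comp[OF _ bilinear_opD(2)[OF diamond_SM_bilinear]]
  bilinear_opD(1,2)[OF diamond_SM_bilinear]

lemma SM_linear_id: "(\<lambda>x. x) \<in> linear_maps K SM SM"
  by (rule linear_mapsI) auto

lemma diamond_comm:
  assumes "x \<in> carrier SM" "y \<in> carrier SM"
  shows "x \<diamondop> y = y \<diamondop> x"
  by (rule Sh_bilinear_eq[OF SM.module_axioms, of diamond "\<lambda>x y. y \<diamondop> x"])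
    (use assms in \<open>simp_all add: diamond_t m_comm mul_comm SM_intros\<close>)

lemma diamond_assoc:
  assumes "x \<in> carrier SM" "y \<in> carrier SM" "z \<in> carrier SM"
  shows "(x \<diamondop> y) \<diamondop> z = x \<diamondop> (y \<diamondop> z)"
proof (rule Sh_linear_eq[OF SM.module_axioms _ _ _ assms(3), of "\<lambda>z. (x \<diamondop> y) \<diamondop> z" "\<lambda>z. x \<diamondop> (y \<diamondop> z)"])
  fix c w assume c: "c \<in> carrier A" "w \<in> words"
  show "(x \<diamondop> y) \<diamondop> t c (p w) = x \<diamondop> (y \<diamondop> t c (p w))"
    by (rule Sh_bilinear_eq[OF SM.module_axioms, of "\<lambda>x y. (x \<diamondop> y) \<diamondop> t c (p w)" "\<lambda>x y. x \<diamondop> (y \<diamondop> t c (p w))"])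
      (use assms c in \<open>simp_all add: diamond_t m_assoc mul_assoc SM_intros\<close>)
qed (use assms in \<open>auto intro!: SM_intros\<close>)

lemma diamond_one:
  assumes "x \<in> carrier SM"
  shows "p [\<one>\<^bsub>A\<^esub>] \<diamondop> x = x"
  by (rule Sh_linear_eq[OF SM.module_axioms _ _ _ assms, of "\<lambda>x. p [\<one>\<^bsub>A\<^esub>] \<diamondop> x" "\<lambda>x. x"])
    (simp_all add: SM_intros SM_linear_id pure_singleton diamond_t)

lemma Sh_algebra: "algebra K (Sh K A l)"
proof (rule algebraI)
  show "cring K" by (rule R.is_cring)
  show "cring (Sh K A l)"
  proof (rule cringI)
    have "add_monoid (Sh K A l) = add_monoid SM" by (simp add: Sh_def)
    then show "abelian_group (Sh K A l)"
      using SM.M.a_comm_group by (intro comm_group_abelian_groupI) simp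
    show "comm_monoid (Sh K A l)"
    proof (rule comm_monoidI)
      fix x y assume "x \<in> carrier (Sh K A l)" "y \<in> carrier (Sh K A l)"
      then show "x \<otimes>\<^bsub>Sh K A l\<^esub> y \<in> carrier (Sh K A l)" "x \<otimes>\<^bsub>Sh K A l\<^esub> y = y \<otimes>\<^bsub>Sh K A l\<^esub> x"
        by (simp_all add: td_diamond_eq diamond_comm)
    qed (simp_all add: td_diamond_eq diamond_assoc diamond_one)
    fix x y z assume "x \<in> carrier (Sh K A l)" "y \<in> carrier (Sh K A l)" "z \<in> carrier (Sh K A l)"
    then show "(x \<oplus>\<^bsub>Sh K A l\<^esub> y) \<otimes>\<^bsub>Sh K A l\<^esub> z = x \<otimes>\<^bsub>Sh K A l\<^esub> z \<oplus>\<^bsub>Sh K A l\<^esub> y \<otimes>\<^bsub>Sh K A l\<^esub> z"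
      using SM.M.a_closed[of x y] by (simp add: td_diamond_eq diamond_add_left SM_S)
  qed
  fix c x y assume "c \<in> carrier K" "x \<in> carrier (Sh K A l)" "y \<in> carrier (Sh K A l)"
  then show "c \<odot>\<^bsub>Sh K A l\<^esub> x \<otimes>\<^bsub>Sh K A l\<^esub> y = c \<odot>\<^bsub>Sh K A l\<^esub> (x \<otimes>\<^bsub>Sh K A l\<^esub> y)"
    using SM.smult_closed[of c x] by (simp add: td_diamond_eq diamond_smult_left SM_S)
qed (use SM.smult_closed in \<open>simp_all add: S.smult_l_distr S.smult_r_distr S.smult_assoc1 SM_S\<close>)

text \<open>The right-hand side is the argument of P in the TD identity. Multiplying a \<otimes> x
  by 1 \<otimes> (b \<otimes> y) keeps the letter a and shuffles x with all of b \<otimes> y, which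
  is the first term of the recursion; the other three arise likewise, the last one from P(1) = 1
  \<otimes> 1. The TD identity thereby says that (1 \<otimes> x) times (1 \<otimes> y) is 1
  \<otimes> (x * y).\<close>

lemma mul_eq_diamond:
  assumes "x \<in> carrier SM" "y \<in> carrier SM"
  shows "x \<star> y = x \<diamondop> t \<one>\<^bsub>A\<^esub> y \<oplus>\<^bsub>S\<^esub> t \<one>\<^bsub>A\<^esub> x \<diamondop> y \<oplus>\<^bsub>S\<^esub> l \<odot>\<^bsub>S\<^esub> (x \<diamondop> y)
    \<ominus>\<^bsub>S\<^esub> (x \<diamondop> t \<one>\<^bsub>A\<^esub> (p [\<one>\<^bsub>A\<^esub>]) \<diamondop> y)"
proof (rule Sh_bilinear_eq[OF S.module_axioms _ _ _ _ _ assms, of mul "\<lambda>x y. x \<diamondop> t \<one>\<^bsub>A\<^esub> y \<oplus>\<^bsub>S\<^esub> t \<one>\<^bsub>A\<^esub> x \<diamondop> y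
      \<oplus>\<^bsub>S\<^esub> l \<odot>\<^bsub>S\<^esub> (x \<diamondop> y) \<ominus>\<^bsub>S\<^esub> (x \<diamondop> t \<one>\<^bsub>A\<^esub> (p [\<one>\<^bsub>A\<^esub>]) \<diamondop> y)"])
  fix a b x y assume h: "a \<in> carrier A" "b \<in> carrier A" "x \<in> carrier S" "y \<in> carrier S"
  have e: "t (a \<otimes>\<^bsub>A\<^esub> b) (tau (x \<star> y)) = l \<odot>\<^bsub>S\<^esub> t (a \<otimes>\<^bsub>A\<^esub> b) (x \<star> y)
      \<ominus>\<^bsub>S\<^esub> t (a \<otimes>\<^bsub>A\<^esub> b) (x \<star> p [\<one>\<^bsub>A\<^esub>] \<star> y)"
    using h by (simp add: tau_mul_eq t_minus t_smult)
  show "t a x \<star> t b y = t a x \<diamondop> t \<one>\<^bsub>A\<^esub> (t b y) \<oplus>\<^bsub>S\<^esub> t \<one>\<^bsub>A\<^esub> (t a x) \<diamondop> t b y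
      \<oplus>\<^bsub>S\<^esub> l \<odot>\<^bsub>S\<^esub> (t a x \<diamondop> t b y) \<ominus>\<^bsub>S\<^esub> (t a x \<diamondop> t \<one>\<^bsub>A\<^esub> (p [\<one>\<^bsub>A\<^esub>]) \<diamondop> t b y)"
    using h by (simp add: mul_t e diamond_t a_minus_def S.M.a_assoc)
qed (auto intro!: linear_maps_SM diamond_linear_intros bilinear_opD(1,2)[OF mul_bilinear] bilinear_opD(1)[OF diamond_bilinear] SM_S)

lemma right_shift_linear: "t \<one>\<^bsub>A\<^esub> \<in> linear_maps K SM SM"
  by (intro linear_maps_to_SM linear_maps_SM t_linear) (auto intro: SM_S)

lemma Sh_td_algebra: "td_algebra K (Sh K A l) l (right_shift K A)"
proof (intro td_algebra.intro td_algebra_axioms.intro Sh_algebra)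
  show "right_shift K A \<in> linear_maps K (Sh K A l) (Sh K A l)"
    using right_shift_linear by (simp add: right_shift_def linear_maps_Sh)
  fix x y assume "x \<in> carrier (Sh K A l)" "y \<in> carrier (Sh K A l)"
  then have x: "x \<in> carrier SM" and y: "y \<in> carrier SM" by simp_all
  note cl = linear_mapsD(1)[OF right_shift_linear] x y
  \<comment> \<open>\<open>Sh_a_minus\<close> replaces the subtraction of \<open>Sh K A l\<close> by
    that of \<open>S\<close> for arguments in the carrier.\<close>
  have sum: "x \<diamondop> t \<one>\<^bsub>A\<^esub> y \<oplus>\<^bsub>S\<^esub> t \<one>\<^bsub>A\<^esub> x \<diamondop> y \<oplus>\<^bsub>S\<^esub> l \<odot>\<^bsub>S\<^esub> (x \<diamondop> y) \<in> carrier SM"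
    using SM.M.a_closed SM.smult_closed cl by simp
  have "t \<one>\<^bsub>A\<^esub> x \<diamondop> t \<one>\<^bsub>A\<^esub> y = t \<one>\<^bsub>A\<^esub> (x \<star> y)"
    using x y by (simp add: diamond_t SM_S)
  then show "right_shift K A x \<otimes>\<^bsub>Sh K A l\<^esub> right_shift K A y =
      right_shift K A (x \<otimes>\<^bsub>Sh K A l\<^esub> right_shift K A y \<oplus>\<^bsub>Sh K A l\<^esub> right_shift K A x \<otimes>\<^bsub>Sh K A l\<^esub> y
        \<oplus>\<^bsub>Sh K A l\<^esub> l \<odot>\<^bsub>Sh K A l\<^esub> (x \<otimes>\<^bsub>Sh K A l\<^esub> y)
        \<ominus>\<^bsub>Sh K A l\<^esub> x \<otimes>\<^bsub>Sh K A l\<^esub> right_shift K A \<one>\<^bsub>Sh K A l\<^esub> \<otimes>\<^bsub>Sh K A l\<^esub> y)"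
    using cl sum by (simp add: right_shift_def td_diamond_eq mul_eq_diamond Sh_a_minus)
qed

lemma Sh_embed_hom: "Sh_embed K A \<in> algebra_hom K A (Sh K A l)"
  unfolding algebra_hom_def linear_maps_Sh
proof (intro IntI ring_hom_memI)
  have lin: "Sh_embed K A \<in> linear_maps K A S"
    using p_Cons_linear[of "[]"] by (simp add: Sh_embed_def[abs_def])
  show "Sh_embed K A \<in> linear_maps K A SM"
    by (rule linear_maps_to_SM[OF lin]) (simp add: Sh_embed_def)
  fix a b assume a: "a \<in> carrier A" and b: "b \<in> carrier A"
  then show "Sh_embed K A a \<in> carrier (Sh K A l)" by (simp add: Sh_embed_def pure_singleton)
  show "Sh_embed K A (a \<otimes>\<^bsub>A\<^esub> b) = Sh_embed K A a \<otimes>\<^bsub>Sh K A l\<^esub> Sh_embed K A b"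
    using a b by (simp add: Sh_embed_def pure_singleton td_diamond_eq diamond_t)
  show "Sh_embed K A (a \<oplus>\<^bsub>A\<^esub> b) = Sh_embed K A a \<oplus>\<^bsub>Sh K A l\<^esub> Sh_embed K A b"
    using linear_mapsD(2)[OF lin a b] by simp
qed (simp add: Sh_embed_def)

end

section \<open>The universal property\<close>

locale td_target = shuffle_setup K A l + Q: td_algebra K R l P
  for K :: "('k, 'm) ring_scheme" and A :: "('k, 'a, 'n) module_scheme" and l :: 'k
    and R :: "('k, 'r, 'q) module_scheme" and P :: "'r \<Rightarrow> 'r" +
  fixes f :: "'a \<Rightarrow> 'r"
  assumes f_hom: "f \<in> algebra_hom K A R"
begin

lemma f_rules:
  shows "f \<in> linear_maps K A R"
    and "a \<in> carrier A \<Longrightarrow> f a \<in> carrier R"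
    and "a \<in> carrier A \<Longrightarrow> b \<in> carrier A \<Longrightarrow> f (a \<otimes>\<^bsub>A\<^esub> b) = f a \<otimes>\<^bsub>R\<^esub> f b"
    and "f \<one>\<^bsub>A\<^esub> = \<one>\<^bsub>R\<^esub>"
  using f_hom by (auto simp: algebra_hom_def ring_hom_def)

lemma P_rules:
  shows "x \<in> carrier R \<Longrightarrow> P x \<in> carrier R"
    and "x \<in> carrier R \<Longrightarrow> y \<in> carrier R \<Longrightarrow> P (x \<oplus>\<^bsub>R\<^esub> y) = P x \<oplus>\<^bsub>R\<^esub> P y"
    and "c \<in> carrier K \<Longrightarrow> x \<in> carrier R \<Longrightarrow> P (c \<odot>\<^bsub>R\<^esub> x) = c \<odot>\<^bsub>R\<^esub> P x"
  using linear_mapsD[OF Q.P_linear] by auto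

lemmas f_closed [simp] = f_rules(2)
lemmas P_closed [simp] = P_rules(1)

lemma R_mult_linear: "z \<in> carrier R \<Longrightarrow> (\<lambda>x. z \<otimes>\<^bsub>R\<^esub> x) \<in> linear_maps K R R"
  using Q.smult_assoc2 by (intro linear_mapsI) (simp_all add: Q.r_distr Q.m_comm[of z])

lemma R_mult_linear': "z \<in> carrier R \<Longrightarrow> (\<lambda>x. x \<otimes>\<^bsub>R\<^esub> z) \<in> linear_maps K R R"
  using Q.smult_assoc2 by (intro linear_mapsI) (simp_all add: Q.l_distr)

lemma smult_assoc_right:
  "c \<in> carrier K \<Longrightarrow> x \<in> carrier R \<Longrightarrow> y \<in> carrier R \<Longrightarrow> x \<otimes>\<^bsub>R\<^esub> (c \<odot>\<^bsub>R\<^esub> y) = c \<odot>\<^bsub>R\<^esub> (x \<otimes>\<^bsub>R\<^esub> y)"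
  using linear_mapsD(3)[OF R_mult_linear] .

fun word_lift_plus :: "'a list \<Rightarrow> 'r"
  where
    "word_lift_plus [] = \<one>\<^bsub>R\<^esub>"
  | "word_lift_plus (a # w) = P (f a \<otimes>\<^bsub>R\<^esub> word_lift_plus w)"

lemma word_lift_plus_multilinear: "multilinear K A R word_lift_plus"
  unfolding multilinear_def
proof (intro conjI ballI)
  show cl: "word_lift_plus w \<in> carrier R" if "w \<in> words" for w
    using that by (induction w rule: list.induct) simp_all
  fix u v assume "u \<in> words" "v \<in> words"
  then show "(\<lambda>x. word_lift_plus (u @ x # v)) \<in> linear_maps K A R"
  proof (induction u rule: list.induct)
    case Nil
    then show ?case using cl[of v]
      by (simp add: linear_maps_comp[OF linear_maps_comp[OF f_rules(1) R_mult_linear'] Q.P_linear])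
  next
    case (Cons a u)
    then have IH: "(\<lambda>x. word_lift_plus (u @ x # v)) \<in> linear_maps K A R" "f a \<in> carrier R" by simp_all
    show ?case
      using linear_maps_comp[OF linear_maps_comp[OF IH(1) R_mult_linear[OF IH(2)]] Q.P_linear] by simp
  qed
qed

definition lift_plus :: "('k, 'a) tensors \<Rightarrow> 'r"
  where "lift_plus = (SOME F. F \<in> linear_maps K S R \<and> (\<forall>w\<in>words. F (p w) = word_lift_plus w))"

lemma lift_plus_linear: "lift_plus \<in> linear_maps K S R"
  and lift_plus_pure: "w \<in> words \<Longrightarrow> lift_plus (p w) = word_lift_plus w"
proof -
  have "\<exists>F. F \<in> linear_maps K S R \<and> (\<forall>w\<in>words. F (p w) = word_lift_plus w)"
    using Sh_plus_lift[OF Q.module word_lift_plus_multilinear] by blast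
  from someI_ex[OF this] have "lift_plus \<in> linear_maps K S R \<and> (\<forall>w\<in>words. lift_plus (p w) = word_lift_plus w)"
    unfolding lift_plus_def .
  then show "lift_plus \<in> linear_maps K S R" "w \<in> words \<Longrightarrow> lift_plus (p w) = word_lift_plus w" by auto
qed

lemma lift_plus_closed [simp]: "x \<in> carrier S \<Longrightarrow> lift_plus x \<in> carrier R"
  using linear_mapsD(1)[OF lift_plus_linear] .

lemmas lift_plus_add = linear_mapsD(2)[OF lift_plus_linear]
lemmas lift_plus_smult = linear_mapsD(3)[OF lift_plus_linear]
lemmas lift_plus_minus = linear_maps_minus[OF S.module_axioms Q.module lift_plus_linear]

lemma lift_plus_t:
  assumes "a \<in> carrier A" "x \<in> carrier S"
  shows "lift_plus (t a x) = P (f a \<otimes>\<^bsub>R\<^esub> lift_plus x)"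
  by (rule Sh_plus_linear_eq[OF Q.module _ _ _ assms(2), of "\<lambda>x. lift_plus (t a x)" "\<lambda>x. P (f a \<otimes>\<^bsub>R\<^esub> lift_plus x)"])
    (use assms(1) in \<open>simp_all add: t_pure lift_plus_pure linear_maps_comp[OF t_linear lift_plus_linear]
      linear_maps_comp[OF linear_maps_comp[OF lift_plus_linear R_mult_linear] Q.P_linear]\<close>)

text \<open>This is the image of l - 1_A under \<open>lift_plus\<close>, since the unit of
  \<open>A\<close> in degree one is sent to P(1).\<close>

definition weight :: 'r
  where "weight = l \<odot>\<^bsub>R\<^esub> \<one>\<^bsub>R\<^esub> \<ominus>\<^bsub>R\<^esub> P \<one>\<^bsub>R\<^esub>"

lemma weight_closed [simp]: "weight \<in> carrier R"
  by (simp add: weight_def)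

lemma mult_weight: "x \<in> carrier R \<Longrightarrow> x \<otimes>\<^bsub>R\<^esub> weight = l \<odot>\<^bsub>R\<^esub> x \<ominus>\<^bsub>R\<^esub> x \<otimes>\<^bsub>R\<^esub> P \<one>\<^bsub>R\<^esub>"
  by (simp add: weight_def linear_maps_minus[OF Q.module Q.module R_mult_linear] smult_assoc_right)

text \<open>In the TD identity for \<open>y\<close> and the unit the terms y P(1) cancel, so P(y)
  P(1) = P(P(y)) + l P(y). This mirrors the product of a nonempty word with the unit of
  \<open>A\<close>.\<close>

lemma P_mult_weight:
  assumes y: "y \<in> carrier R"
  shows "P y \<otimes>\<^bsub>R\<^esub> weight = \<ominus>\<^bsub>R\<^esub> P (P y)"
proof -
  define z where "z = y \<otimes>\<^bsub>R\<^esub> P \<one>\<^bsub>R\<^esub>"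
  have z: "z \<in> carrier R" using y by (simp add: z_def)
  have "z \<oplus>\<^bsub>R\<^esub> P y \<oplus>\<^bsub>R\<^esub> l \<odot>\<^bsub>R\<^esub> y \<ominus>\<^bsub>R\<^esub> z = z \<oplus>\<^bsub>R\<^esub> ((P y \<oplus>\<^bsub>R\<^esub> l \<odot>\<^bsub>R\<^esub> y) \<ominus>\<^bsub>R\<^esub> z)"
    using y z by (simp add: a_minus_def Q.M.a_assoc)
  also have "\<dots> = P y \<oplus>\<^bsub>R\<^esub> l \<odot>\<^bsub>R\<^esub> y" using y z by (intro Q.M.add_minus_cancel) simp_all
  finally have "P y \<otimes>\<^bsub>R\<^esub> P \<one>\<^bsub>R\<^esub> = P (P y \<oplus>\<^bsub>R\<^esub> l \<odot>\<^bsub>R\<^esub> y)"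
    using Q.P_td[OF y Q.one_closed] y z by (simp add: z_def[symmetric])
  then show ?thesis using y by (simp add: mult_weight P_rules Q.M.minus_add_cancel)
qed

text \<open>On the empty word both sides are \<open>weight\<close>. On a nonempty word
  \<open>tau\<close> prefixes the unit of \<open>A\<close> and changes the sign, and
  \<open>P_mult_weight\<close> is the same rule in the target.\<close>

lemma lift_plus_tau:
  assumes "x \<in> carrier S"
  shows "lift_plus (tau x) = lift_plus x \<otimes>\<^bsub>R\<^esub> weight"
proof (rule Sh_plus_linear_eq[OF Q.module linear_maps_comp[OF tau_linear lift_plus_linear]
      linear_maps_comp[OF lift_plus_linear R_mult_linear'] _ assms])
  fix w assume w: "w \<in> words"
  show "lift_plus (tau (p w)) = lift_plus (p w) \<otimes>\<^bsub>R\<^esub> weight"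
  proof (cases w)
    case Nil
    then show ?thesis by (simp add: tau_def lift_plus_minus lift_plus_smult lift_plus_t lift_plus_pure f_rules weight_def)
  next
    case (Cons b v)
    then have h: "b \<in> carrier A" "v \<in> words" "p w = t b (p v)" using w by (simp_all add: t_pure)
    have "lift_plus (tau (p w)) = \<zero>\<^bsub>R\<^esub> \<ominus>\<^bsub>R\<^esub> P (P (f b \<otimes>\<^bsub>R\<^esub> lift_plus (p v)))"
      using h linear_maps_zero[OF S.module_axioms Q.module lift_plus_linear]
      by (simp add: tau_def lift_plus_minus lift_plus_t f_rules)
    then show ?thesis using h by (simp add: lift_plus_t P_mult_weight a_minus_def)
  qed
qed simp

lemma lift_plus_mul:
  assumes "x \<in> carrier S" "y \<in> carrier S"
  shows "lift_plus (x \<star> y) = lift_plus x \<otimes>\<^bsub>R\<^esub> lift_plus y"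
proof -
  have pure: "lift_plus (p u \<star> p v) = lift_plus (p u) \<otimes>\<^bsub>R\<^esub> lift_plus (p v)" if "u \<in> words" "v \<in> words" for u v
    using that
  proof (induction u v rule: word_shuffle.induct)
    case (1 v)
    then show ?case by (simp add: lift_plus_pure word_lift_plus_multilinear[THEN multilinearD(1)])
  next
    case (2 a u)
    then show ?case by (simp add: lift_plus_pure word_lift_plus_multilinear[THEN multilinearD(1)])
  next
    case (3 a u b v)
    then have h: "a \<in> carrier A" "b \<in> carrier A" "u \<in> words" "v \<in> words" by simp_all
    \<comment> \<open>Chosen so that the two factors are sent to P(X) and P(Y); the three terms of
      the recursion then become P applied to X P(Y), to P(X) Y and to X Y times
      \<open>weight\<close>.\<close>
    define X where "X = f a \<otimes>\<^bsub>R\<^esub> lift_plus (p u)"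
    define Y where "Y = f b \<otimes>\<^bsub>R\<^esub> lift_plus (p v)"
    have XY: "X \<in> carrier R" "Y \<in> carrier R" using h by (simp_all add: X_def Y_def)
    have kX: "lift_plus (t a (p u)) = P X" and kY: "lift_plus (t b (p v)) = P Y" using h by (simp_all add: lift_plus_t X_def Y_def)
    have IH: "lift_plus (p u \<star> t b (p v)) = lift_plus (p u) \<otimes>\<^bsub>R\<^esub> P Y" "lift_plus (t a (p u) \<star> p v) = P X \<otimes>\<^bsub>R\<^esub> lift_plus (p v)"
      "lift_plus (p u \<star> p v) = lift_plus (p u) \<otimes>\<^bsub>R\<^esub> lift_plus (p v)"
      using 3 h kX kY by (simp_all add: t_pure)
    have "lift_plus (t a (p u) \<star> t b (p v)) = P (f a \<otimes>\<^bsub>R\<^esub> (lift_plus (p u) \<otimes>\<^bsub>R\<^esub> P Y)) \<oplus>\<^bsub>R\<^esub> P (f b \<otimes>\<^bsub>R\<^esub> (P X \<otimes>\<^bsub>R\<^esub> lift_plus (p v)))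
        \<oplus>\<^bsub>R\<^esub> P (f a \<otimes>\<^bsub>R\<^esub> f b \<otimes>\<^bsub>R\<^esub> (lift_plus (p u) \<otimes>\<^bsub>R\<^esub> lift_plus (p v) \<otimes>\<^bsub>R\<^esub> weight))"
      using h by (simp add: mul_t lift_plus_add lift_plus_t lift_plus_tau IH f_rules)
    also have "f a \<otimes>\<^bsub>R\<^esub> (lift_plus (p u) \<otimes>\<^bsub>R\<^esub> P Y) = X \<otimes>\<^bsub>R\<^esub> P Y"
      using h XY by (simp add: X_def Q.m_assoc)
    also have "f b \<otimes>\<^bsub>R\<^esub> (P X \<otimes>\<^bsub>R\<^esub> lift_plus (p v)) = P X \<otimes>\<^bsub>R\<^esub> Y"
      using h XY by (simp add: Y_def Q.m_lcomm)
    also have "f a \<otimes>\<^bsub>R\<^esub> f b \<otimes>\<^bsub>R\<^esub> (lift_plus (p u) \<otimes>\<^bsub>R\<^esub> lift_plus (p v) \<otimes>\<^bsub>R\<^esub> weight) = X \<otimes>\<^bsub>R\<^esub> Y \<otimes>\<^bsub>R\<^esub> weight"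
      using h by (simp add: X_def Y_def Q.m_ac)
    also have "\<dots> = l \<odot>\<^bsub>R\<^esub> (X \<otimes>\<^bsub>R\<^esub> Y) \<ominus>\<^bsub>R\<^esub> X \<otimes>\<^bsub>R\<^esub> P \<one>\<^bsub>R\<^esub> \<otimes>\<^bsub>R\<^esub> Y"
      using XY by (simp add: mult_weight Q.m_ac)
    also have "P (X \<otimes>\<^bsub>R\<^esub> P Y) \<oplus>\<^bsub>R\<^esub> P (P X \<otimes>\<^bsub>R\<^esub> Y) \<oplus>\<^bsub>R\<^esub> P (l \<odot>\<^bsub>R\<^esub> (X \<otimes>\<^bsub>R\<^esub> Y) \<ominus>\<^bsub>R\<^esub> X \<otimes>\<^bsub>R\<^esub> P \<one>\<^bsub>R\<^esub> \<otimes>\<^bsub>R\<^esub> Y)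
        = P X \<otimes>\<^bsub>R\<^esub> P Y"
      using XY by (simp add: Q.P_td P_rules(2)[symmetric] a_minus_def Q.M.a_assoc)
    finally show ?case using h by (simp add: t_pure kX[symmetric] kY[symmetric])
  qed
  have "lift_plus (p u \<star> y) = lift_plus (p u) \<otimes>\<^bsub>R\<^esub> lift_plus y" if "u \<in> words" for u
    by (rule Sh_plus_linear_eq[OF Q.module _ _ _ assms(2), of "\<lambda>y. lift_plus (p u \<star> y)" "\<lambda>y. lift_plus (p u) \<otimes>\<^bsub>R\<^esub> lift_plus y"])
      (use that pure in \<open>simp_all add: linear_maps_comp[OF bilinear_opD(1)[OF mul_bilinear] lift_plus_linear]
        linear_maps_comp[OF lift_plus_linear R_mult_linear]\<close>)
  then show ?thesis
    by (intro Sh_plus_linear_eq[OF Q.module _ _ _ assms(1), of "\<lambda>x. lift_plus (x \<star> y)" "\<lambda>x. lift_plus x \<otimes>\<^bsub>R\<^esub> lift_plus y"])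
      (use assms in \<open>simp_all add: linear_maps_comp[OF bilinear_opD(2)[OF mul_bilinear] lift_plus_linear]
        linear_maps_comp[OF lift_plus_linear R_mult_linear']\<close>)
qed

text \<open>The empty word is sent to zero: the map is wanted on \<open>SM\<close>, but the lifting
  property asks for a value in degree 0 as well.\<close>

fun word_lift :: "'a list \<Rightarrow> 'r"
  where
    "word_lift [] = \<zero>\<^bsub>R\<^esub>"
  | "word_lift (a # w) = f a \<otimes>\<^bsub>R\<^esub> word_lift_plus w"

lemma word_lift_multilinear: "multilinear K A R word_lift"
proof (rule multilinear_ConsI)
  fix a assume "a \<in> carrier A"
  then show "multilinear K A R (\<lambda>w. word_lift (a # w))"
    using multilinear_comp[OF word_lift_plus_multilinear R_mult_linear] by simp
next
  fix w assume "w \<in> words"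
  then show "(\<lambda>x. word_lift (x # w)) \<in> linear_maps K A R"
    using linear_maps_comp[OF f_rules(1) R_mult_linear'] multilinearD(1)[OF word_lift_plus_multilinear] by simp
qed simp

definition lift :: "('k, 'a) tensors \<Rightarrow> 'r"
  where "lift = (SOME F. F \<in> linear_maps K S R \<and> (\<forall>w\<in>words. F (p w) = word_lift w))"

lemma lift_linear: "lift \<in> linear_maps K S R"
  and lift_pure: "w \<in> words \<Longrightarrow> lift (p w) = word_lift w"
proof -
  have "\<exists>F. F \<in> linear_maps K S R \<and> (\<forall>w\<in>words. F (p w) = word_lift w)"
    using Sh_plus_lift[OF Q.module word_lift_multilinear] by blast
  from someI_ex[OF this] have "lift \<in> linear_maps K S R \<and> (\<forall>w\<in>words. lift (p w) = word_lift w)"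
    unfolding lift_def .
  then show "lift \<in> linear_maps K S R" "w \<in> words \<Longrightarrow> lift (p w) = word_lift w" by auto
qed

lemma lift_closed [simp]: "x \<in> carrier S \<Longrightarrow> lift x \<in> carrier R"
  using linear_mapsD(1)[OF lift_linear] .

lemma lift_t:
  assumes "a \<in> carrier A" "x \<in> carrier S"
  shows "lift (t a x) = f a \<otimes>\<^bsub>R\<^esub> lift_plus x"
  by (rule Sh_plus_linear_eq[OF Q.module _ _ _ assms(2), of "\<lambda>x. lift (t a x)" "\<lambda>x. f a \<otimes>\<^bsub>R\<^esub> lift_plus x"])
    (use assms(1) in \<open>simp_all add: t_pure lift_plus_pure lift_pure linear_maps_comp[OF t_linear lift_linear]
      linear_maps_comp[OF lift_plus_linear R_mult_linear]\<close>)

text \<open>Both sides send a \<otimes> x to P(f(a) h(x)), with h the map \<open>lift_plus\<close>.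
  Compatibility with the operators follows, because \<open>lift\<close> of 1 \<otimes> x is
  \<open>lift_plus x\<close>.\<close>

lemma lift_plus_eq_P_g:
  assumes "x \<in> carrier SM"
  shows "lift_plus x = P (lift x)"
  by (rule Sh_linear_eq[OF Q.module linear_maps_SM[OF lift_plus_linear]
        linear_maps_SM[OF linear_maps_comp[OF lift_linear Q.P_linear]] _ assms])
    (simp add: lift_plus_t lift_t)

lemma lift_diamond:
  assumes "x \<in> carrier SM" "y \<in> carrier SM"
  shows "lift (x \<diamondop> y) = lift x \<otimes>\<^bsub>R\<^esub> lift y"
proof (rule Sh_bilinear_eq[OF Q.module _ _ _ _ _ assms, of "\<lambda>x y. lift (x \<diamondop> y)" "\<lambda>x y. lift x \<otimes>\<^bsub>R\<^esub> lift y"])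
  fix x assume x: "x \<in> carrier SM"
  then have xS: "x \<in> carrier S" by (rule SM_S)
  show "(\<lambda>y. lift (x \<diamondop> y)) \<in> linear_maps K SM R" "(\<lambda>y. lift (y \<diamondop> x)) \<in> linear_maps K SM R"
    by (intro linear_maps_SM linear_maps_comp[OF bilinear_opD(1)[OF diamond_bilinear xS] lift_linear]
        linear_maps_comp[OF bilinear_opD(2)[OF diamond_bilinear xS] lift_linear])+
  show "(\<lambda>y. lift x \<otimes>\<^bsub>R\<^esub> lift y) \<in> linear_maps K SM R" "(\<lambda>y. lift y \<otimes>\<^bsub>R\<^esub> lift x) \<in> linear_maps K SM R"
    by (rule linear_maps_SM[OF linear_maps_comp[OF lift_linear R_mult_linear[OF lift_closed[OF xS]]]]
        linear_maps_SM[OF linear_maps_comp[OF lift_linear R_mult_linear'[OF lift_closed[OF xS]]]])+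
qed (simp add: diamond_t lift_t lift_plus_mul f_rules Q.m_ac)

section \<open>Existence and uniqueness of the extension\<close>

lemma lift_td_hom: "restrict lift (carrier SM) \<in> td_hom K (Sh K A l) (right_shift K A) R P"
  unfolding td_hom_def algebra_hom_def
proof (intro CollectI conjI IntI ballI ring_hom_memI)
  let ?lift = "restrict lift (carrier SM)"
  note lin = linear_maps_restrict[OF SM.module_axioms linear_maps_SM[OF lift_linear]]
  show "?lift \<in> linear_maps K (Sh K A l) R" using lin by (simp add: linear_maps_Sh)
  show "?lift \<one>\<^bsub>Sh K A l\<^esub> = \<one>\<^bsub>R\<^esub>" using one_SM by (simp add: lift_pure f_rules)
  fix x assume "x \<in> carrier (Sh K A l)"
  then have x: "x \<in> carrier SM" by simp
  then have xS: "x \<in> carrier S" by (rule SM_S)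
  show "?lift x \<in> carrier R" using x xS by simp
  show "?lift (right_shift K A x) = P (?lift x)"
    using x xS by (simp add: right_shift_def lift_t f_rules lift_plus_eq_P_g[symmetric])
  fix y assume "y \<in> carrier (Sh K A l)"
  then have y: "y \<in> carrier SM" by simp
  show "?lift (x \<otimes>\<^bsub>Sh K A l\<^esub> y) = ?lift x \<otimes>\<^bsub>R\<^esub> ?lift y"
    using x y by (simp add: td_diamond_eq lift_diamond)
  show "?lift (x \<oplus>\<^bsub>Sh K A l\<^esub> y) = ?lift x \<oplus>\<^bsub>R\<^esub> ?lift y"
    using linear_mapsD(2)[OF lin x y] by simp
qed

text \<open>There is no freedom: a \<otimes> (b \<otimes> w) is the product of a, embedded in degree
  one, with the right shift of b \<otimes> w. Its value is therefore f(a) P(h(b \<otimes> w)), and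
  induction on the word descends to degree one, where h is f.\<close>

lemma td_hom_unique:
  assumes h: "h \<in> td_hom K (Sh K A l) (right_shift K A) R P"
    and hf: "\<And>a. a \<in> carrier A \<Longrightarrow> f a = h (Sh_embed K A a)"
    and x: "x \<in> carrier SM"
  shows "h x = lift x"
proof (rule Sh_linear_eq[OF Q.module _ linear_maps_SM[OF lift_linear] _ x])
  show "h \<in> linear_maps K SM R"
    using h by (simp add: td_hom_def algebra_hom_def linear_maps_Sh)
  have hm: "h (x \<diamondop> y) = h x \<otimes>\<^bsub>R\<^esub> h y" if "x \<in> carrier SM" "y \<in> carrier SM" for x y
    using h that ring_hom_mult[of h "Sh K A l" R x y]
    by (simp add: td_hom_def algebra_hom_def td_diamond_eq)
  have hP: "h (t \<one>\<^bsub>A\<^esub> x) = P (h x)" if "x \<in> carrier SM" for x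
    using h that by (simp add: td_hom_def right_shift_def)
  have "h (t a (p w)) = f a \<otimes>\<^bsub>R\<^esub> word_lift_plus w" if "w \<in> words" "a \<in> carrier A" for a w
    using that
  \<comment> \<open>The leading letter is generalised because the hypothesis is applied with the
    next letter in its place.\<close>
  proof (induction w arbitrary: a rule: list.induct)
    case Nil
    then show ?case using hf[of a] f_closed[of a] by (simp add: Sh_embed_def pure_singleton)
  next
    case (Cons b w)
    then have m: "b \<in> carrier A" "w \<in> words" "a \<in> carrier A" by simp_all
    have ha: "h (p [a]) = f a" using hf[OF m(3)] by (simp add: Sh_embed_def)
    have c: "p [a] \<in> carrier SM" "t b (p w) \<in> carrier SM" "t \<one>\<^bsub>A\<^esub> (t b (p w)) \<in> carrier SM"
      using m by (simp_all add: pure_singleton)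
    have "t a (p (b # w)) = t a (t b (p w))" using m by (simp add: t_pure)
    also have "\<dots> = p [a] \<diamondop> t \<one>\<^bsub>A\<^esub> (t b (p w))"
      using m by (simp add: pure_singleton diamond_t)
    finally show ?case using m c by (simp add: hm hP ha Cons.IH)
  qed
  then show "h (t a (p w)) = lift (t a (p w))" if "a \<in> carrier A" "w \<in> words" for a w
    using that by (simp add: lift_t lift_plus_pure)
qed

lemma universal:
  "\<exists>!h. h \<in> extensional (carrier (Sh K A l)) \<and> h \<in> td_hom K (Sh K A l) (right_shift K A) R P \<and>
    (\<forall>a\<in>carrier A. f a = h (Sh_embed K A a))"
proof (rule ex1I)
  show "restrict lift (carrier SM) \<in> extensional (carrier (Sh K A l)) \<and>
      restrict lift (carrier SM) \<in> td_hom K (Sh K A l) (right_shift K A) R P \<and>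
      (\<forall>a\<in>carrier A. f a = restrict lift (carrier SM) (Sh_embed K A a))"
    using lift_td_hom by (simp add: Sh_embed_def pure_singleton lift_t lift_plus_pure)
  fix h assume h: "h \<in> extensional (carrier (Sh K A l)) \<and> h \<in> td_hom K (Sh K A l) (right_shift K A) R P \<and>
    (\<forall>a\<in>carrier A. f a = h (Sh_embed K A a))"
  show "h = restrict lift (carrier SM)"
    by (rule extensionalityI[where A = "carrier SM"]) (use h td_hom_unique in auto)
qed

end

theorem theorem2p12:
  fixes K :: "('k, 'm) ring_scheme"
    and A :: "('k, 'a, 'n) module_scheme"
    and l :: 'k
  assumes "cring K" and "l \<in> carrier K" and "algebra K A"
  shows "td_algebra K (Sh K A l) l (right_shift K A) \<and>
    Sh_embed K A \<in> algebra_hom K A (Sh K A l) \<and>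
    (\<forall>(R :: ('k, 'r, 'q) module_scheme) P f.
       td_algebra K R l P \<and> f \<in> algebra_hom K A R \<longrightarrow>
       (\<exists>!g. g \<in> extensional (carrier (Sh K A l)) \<and>
             g \<in> td_hom K (Sh K A l) (right_shift K A) R P \<and>
             (\<forall>a\<in>carrier A. f a = g (Sh_embed K A a))))"
proof -
  have base: "shuffle_setup K A l"
    using assms by (intro shuffle_setup.intro tensor_setup.intro shuffle_setup_axioms.intro)
  show ?thesis
  proof (intro conjI allI impI)
    fix R :: "('k, 'r, 'q) module_scheme" and P f
    assume "td_algebra K R l P \<and> f \<in> algebra_hom K A R"
    then have "td_target K A l R P f"
      using base by (intro td_target.intro td_target_axioms.intro) simp_all
    then show "\<exists>!g. g \<in> extensional (carrier (Sh K A l)) \<and>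
        g \<in> td_hom K (Sh K A l) (right_shift K A) R P \<and> (\<forall>a\<in>carrier A. f a = g (Sh_embed K A a))"
      by (rule td_target.universal)
  qed (rule shuffle_setup.Sh_td_algebra[OF base] shuffle_setup.Sh_embed_hom[OF base])+
qed

end
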